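(* Let $\mathcal{M}=(E,\mathcal{I})$ be a matroid satisfying the $\alpha$-partition property for some $\alpha\ge1$. Consider the single-sample prophet inequality problem on $\mathcal{M}$: each element $e\in E$ has a distribution $D_e$ over nonnegative reals, independent across elements; a reward $r_e\sim D_e$ and one sample $s_e\sim D_e$ are drawn independently; the samples are known to the policy in advance, elements arrive in adversarial order, and on arrival of $e$ the policy observes $r_e$ and irrevocably decides whether to accept it, the accepted set having to remain in $\mathcal{I}$. Then there exists a policy for this problem whose accepted set $A$ satisfies $2\alpha\cdot\mathbb{E}[\sum_{e\in A}r_e]\ge\mathbb{E}[\max_{T\in\mathcal{I}}\sum_{e\in T}r_e]$ for every arrival order. Moreover, if the $\alpha$-partitioning can be performed in polynomial time, the policy is efficient.
   Context: A matroid $\mathcal{M}'=(E',\mathcal{I}')$ is a simple partition matroid if there is a partition $E'=\bigcup_{l\in[k]}E_l$ such that $T\in\mathcal{I}'$ iff $|T\cap E_l|\le1$ for all $l$. A matroid $\mathcal{M}=(E,\mathcal{I})$ satisfies the $\alpha$-partition property ($\alpha\ge1$) if for any weight vector $w$ on $E$, after sequentially observing the weights of a (possibly random) subset $S\subset E$ chosen independently of the weights, one can define a simple partition matroid $\mathcal{M}'=(E',\mathcal{I}')$ with $E'\subseteq E\setminus S$ such that $\mathcal{I}'\subseteq\mathcal{I}$ and $\mathbb{E}[\max_{T\in\mathcal{I}'}w(T)]\ge\frac1\alpha\max_{T\in\mathcal{I}}w(T)$, the expectation being over the randomness of the partitioning procedure ($S=\emptyset$ and deterministic procedures are allowed). 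*)

theory Defs
  imports
    "HOL-Probability.Probability"
    "HOL-Library.Disjoint_Sets"
    "HOL-Computational_Algebra.Polynomial"
begin

section \<open>Matroids and weights\<close>

definition matroid :: "'a set \<Rightarrow> 'a set set \<Rightarrow> bool" where
  "matroid E I \<longleftrightarrow>
     finite E \<and> I \<subseteq> Pow E \<and> {} \<in> I \<and>
     (\<forall>X Y. Y \<in> I \<and> X \<subseteq> Y \<longrightarrow> X \<in> I) \<and>
     (\<forall>X\<in>I. \<forall>Y\<in>I. card X < card Y \<longrightarrow> (\<exists>y\<in>Y - X. insert y X \<in> I))"

definition opt :: "'a set set \<Rightarrow> ('a \<Rightarrow> real) \<Rightarrow> real" where
  "opt I w = (MAX T\<in>I. \<Sum>e\<in>T. w e)"

text \<open>Weight vectors are nonnegative throughout. They are extensional functions, so that they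
  are exactly the points of the product space of copies of \<open>nonneg_borel\<close>.\<close>

definition nonneg_vectors :: "'a set \<Rightarrow> ('a \<Rightarrow> real) set" where
  "nonneg_vectors E = (E \<rightarrow>\<^sub>E {0..})"

definition nonneg_borel :: "real measure" where
  "nonneg_borel = restrict_space borel {0..}"


section \<open>The partition property\<close>

text \<open>The simple partition matroid given by the disjoint parts \<open>P\<close>; its ground set is
  \<open>\<Union>P\<close>.\<close>

definition partition_indep :: "'a set set \<Rightarrow> 'a set set" where
  "partition_indep P = {T. T \<subseteq> \<Union>P \<and> (\<forall>B\<in>P. card (T \<inter> B) \<le> 1)}"

text \<open>A randomized partitioning procedure consists of the law \<open>\<sigma>\<close> of the observed set \<open>S\<close>,
  which does not involve the weights, and the conditional law \<open>\<kappa> S v\<close> of the partition given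
  \<open>S\<close> and the observed weights \<open>v\<close> on \<open>S\<close>. As usual for a conditional law, \<open>\<kappa> S\<close> is a
  probability kernel, that is, it depends measurably on \<open>v\<close>.\<close>

definition alpha_partitioning ::
  "'a set \<Rightarrow> 'a set set \<Rightarrow> real \<Rightarrow> 'a set pmf \<Rightarrow> ('a set \<Rightarrow> ('a \<Rightarrow> real) \<Rightarrow> 'a set set pmf) \<Rightarrow> bool"
where
  "alpha_partitioning E I \<alpha> \<sigma> \<kappa> \<longleftrightarrow>
     set_pmf \<sigma> \<subseteq> Pow E \<and>
     (\<forall>S\<in>set_pmf \<sigma>.
        (\<forall>P. (\<lambda>v. pmf (\<kappa> S v) P) \<in> borel_measurable (PiM S (\<lambda>_. nonneg_borel))) \<and>
        (\<forall>v\<in>nonneg_vectors S. \<forall>P\<in>set_pmf (\<kappa> S v).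
           (\<exists>E'\<subseteq>E - S. partition_on E' P) \<and> partition_indep P \<subseteq> I)) \<and>
     (\<forall>w\<in>nonneg_vectors E.
        measure_pmf.expectation (bind_pmf \<sigma> (\<lambda>S. \<kappa> S (restrict w S)))
          (\<lambda>P. opt (partition_indep P) w) \<ge> 1 / \<alpha> * opt I w)"

definition alpha_partition_property :: "'a set \<Rightarrow> 'a set set \<Rightarrow> real \<Rightarrow> bool" where
  "alpha_partition_property E I \<alpha> \<longleftrightarrow> (\<exists>\<sigma> \<kappa>. alpha_partitioning E I \<alpha> \<sigma> \<kappa>)"


section \<open>Single-sample prophet inequalities\<close>

text \<open>An online policy with memory of type \<open>'q\<close>. It knows the samples (first argument of
  both components) but neither the distributions nor the arrival order. \<open>prep\<close> yields the
  initial memory; \<open>decide\<close> is called when an element arrives and its reward is revealed, and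
  yields the irrevocable decision together with the new memory. Both may be randomized.\<close>

record ('a, 'q) policy =
  prep :: "('a \<Rightarrow> real) \<Rightarrow> 'q pmf"
  decide :: "('a \<Rightarrow> real) \<Rightarrow> 'q \<Rightarrow> 'a \<Rightarrow> real \<Rightarrow> (bool \<times> 'q) pmf"

fun accepted_from ::
  "('a, 'q) policy \<Rightarrow> ('a \<Rightarrow> real) \<Rightarrow> ('a \<Rightarrow> real) \<Rightarrow> 'q \<Rightarrow> 'a list \<Rightarrow> 'a set pmf"
where
  "accepted_from \<pi> s r q [] = return_pmf {}"
| "accepted_from \<pi> s r q (e # es) =
     bind_pmf (decide \<pi> s q e (r e))
       (\<lambda>(b, q'). map_pmf (\<lambda>A. if b then insert e A else A) (accepted_from \<pi> s r q' es))"

definition accepted ::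
  "('a, 'q) policy \<Rightarrow> 'a list \<Rightarrow> ('a \<Rightarrow> real) \<Rightarrow> ('a \<Rightarrow> real) \<Rightarrow> 'a set pmf"
where
  "accepted \<pi> es s r = bind_pmf (prep \<pi> s) (\<lambda>q. accepted_from \<pi> s r q es)"

definition arrival_order :: "'a set \<Rightarrow> 'a list \<Rightarrow> bool" where
  "arrival_order E es \<longleftrightarrow> distinct es \<and> set es = E"

text \<open>Since \<open>I\<close> is downward closed, the accepted set lies in \<open>I\<close> at every point in time as
  soon as the final one does. Measurability makes the accepted set a random variable.\<close>

definition valid_policy :: "'a set \<Rightarrow> 'a set set \<Rightarrow> ('a, 'q) policy \<Rightarrow> bool" where
  "valid_policy E I \<pi> \<longleftrightarrow>
     (\<forall>es. arrival_order E es \<longrightarrow>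
        (\<forall>s\<in>nonneg_vectors E. \<forall>r\<in>nonneg_vectors E. set_pmf (accepted \<pi> es s r) \<subseteq> I) \<and>
        (\<forall>A. (\<lambda>(s, r). pmf (accepted \<pi> es s r) A)
           \<in> borel_measurable (PiM E (\<lambda>_. nonneg_borel) \<Otimes>\<^sub>M PiM E (\<lambda>_. nonneg_borel))))"

text \<open>Samples and rewards are independent copies of the product distribution. Expectations
  are taken in \<open>[0, \<infinity>]\<close>, so no integrability is assumed.\<close>

definition competitive :: "real \<Rightarrow> 'a set \<Rightarrow> 'a set set \<Rightarrow> ('a, 'q) policy \<Rightarrow> bool" where
  "competitive c E I \<pi> \<longleftrightarrow>
     (\<forall>D. (\<forall>e\<in>E. prob_space (D e) \<and> sets (D e) = sets nonneg_borel) \<longrightarrow>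
        (\<forall>es. arrival_order E es \<longrightarrow>
           ennreal c *
             (\<integral>\<^sup>+ (s, r). (\<integral>\<^sup>+ A. ennreal (\<Sum>e\<in>A. r e) \<partial>measure_pmf (accepted \<pi> es s r))
                \<partial>(PiM E D \<Otimes>\<^sub>M PiM E D))
           \<ge> (\<integral>\<^sup>+ r. ennreal (opt I r) \<partial>PiM E D)))"


section \<open>Randomized real RAM\<close>

text \<open>Polynomial time refers to programs of a randomized real RAM, run uniformly on a class of
  inputs. An input is a matroid on \<open>{..<num_elems x}\<close>, accessible through an independence
  oracle and, optionally, through a description by a bit string (a graph, for instance).\<close>

record matroid_input =
  num_elems :: nat
  indep :: "nat set set"
  descr :: "bool list"

definition input_size :: "matroid_input \<Rightarrow> nat" where
  "input_size x = num_elems x + length (descr x)"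

definition elems :: "matroid_input \<Rightarrow> nat set" where
  "elems x = {..<num_elems x}"

text \<open>Registers and indirectly addressable memory for natural and for real numbers; \<open>observed\<close>
  is bookkeeping that programs cannot access.\<close>

record store =
  nreg :: "nat \<Rightarrow> nat"
  nmem :: "nat \<Rightarrow> nat"
  rreg :: "nat \<Rightarrow> real"
  rmem :: "nat \<Rightarrow> real"
  observed :: "nat set"

definition blank :: store where
  "blank = \<lparr>nreg = (\<lambda>_. 0), nmem = (\<lambda>_. 0), rreg = (\<lambda>_. 0), rmem = (\<lambda>_. 0), observed = {}\<rparr>"

text \<open>Natural numbers are only added and subtracted, since unit-cost multiplication would allow
  numbers with exponentially many digits.\<close>

datatype nexp =
  NConst nat
| NReg nat
| NMem nexp
| NPlus nexp nexp
| NMinus nexp nexp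
| NNumElems
| NDescrLen
| NDescrBit nexp

datatype rexp =
  ROfNat nexp
| RReg nat
| RMem nexp
| RPlus rexp rexp
| RMinus rexp rexp
| RTimes rexp rexp
| RDivide rexp rexp

datatype bexp =
  NLess nexp nexp
| RLess rexp rexp
| Indep nexp
| BNot bexp
| BAnd bexp bexp

datatype com =
  NSet nat nexp
| NStore nexp nexp
| RSet nat rexp
| RStore nexp rexp
| Observe nat nexp
| Rand nat nexp
| Seq com com
| Cond bexp com com
| While bexp com

primrec neval :: "matroid_input \<Rightarrow> store \<Rightarrow> nexp \<Rightarrow> nat" where
  "neval x q (NConst k) = k"
| "neval x q (NReg i) = nreg q i"
| "neval x q (NMem a) = nmem q (neval x q a)"
| "neval x q (NPlus a b) = neval x q a + neval x q b"
| "neval x q (NMinus a b) = neval x q a - neval x q b"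
| "neval x q NNumElems = num_elems x"
| "neval x q NDescrLen = length (descr x)"
| "neval x q (NDescrBit a) =
     (let i = neval x q a in if i < length (descr x) \<and> descr x ! i then 1 else 0)"

primrec reval :: "matroid_input \<Rightarrow> store \<Rightarrow> rexp \<Rightarrow> real" where
  "reval x q (ROfNat a) = real (neval x q a)"
| "reval x q (RReg i) = rreg q i"
| "reval x q (RMem a) = rmem q (neval x q a)"
| "reval x q (RPlus a b) = reval x q a + reval x q b"
| "reval x q (RMinus a b) = reval x q a - reval x q b"
| "reval x q (RTimes a b) = reval x q a * reval x q b"
| "reval x q (RDivide a b) = reval x q a / reval x q b"

text \<open>\<open>Indep a\<close> queries the oracle with the set whose characteristic vector starts at
  address \<open>a\<close>.\<close>

primrec beval :: "matroid_input \<Rightarrow> store \<Rightarrow> bexp \<Rightarrow> bool" where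
  "beval x q (NLess a b) \<longleftrightarrow> neval x q a < neval x q b"
| "beval x q (RLess a b) \<longleftrightarrow> reval x q a < reval x q b"
| "beval x q (Indep a) \<longleftrightarrow> {e \<in> elems x. nmem q (neval x q a + e) \<noteq> 0} \<in> indep x"
| "beval x q (BNot b) \<longleftrightarrow> \<not> beval x q b"
| "beval x q (BAnd b c) \<longleftrightarrow> beval x q b \<and> beval x q c"

text \<open>One computation step. A configuration consists of the commands still to be executed and
  the store. \<open>w\<close> is the weight vector read by \<open>Observe\<close>; \<open>Rand i a\<close> draws a uniform number
  from \<open>{0..a}\<close>. Evaluating an expression is charged to the command containing it: the
  expressions of a fixed program have bounded size.\<close>

fun step :: "matroid_input \<Rightarrow> (nat \<Rightarrow> real) \<Rightarrow> com list \<times> store \<Rightarrow> (com list \<times> store) pmf" where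
  "step x w ([], q) = return_pmf ([], q)"
| "step x w (NSet i a # cs, q) = return_pmf (cs, q\<lparr>nreg := (nreg q)(i := neval x q a)\<rparr>)"
| "step x w (NStore a b # cs, q) =
     return_pmf (cs, q\<lparr>nmem := (nmem q)(neval x q a := neval x q b)\<rparr>)"
| "step x w (RSet i a # cs, q) = return_pmf (cs, q\<lparr>rreg := (rreg q)(i := reval x q a)\<rparr>)"
| "step x w (RStore a b # cs, q) =
     return_pmf (cs, q\<lparr>rmem := (rmem q)(neval x q a := reval x q b)\<rparr>)"
| "step x w (Observe i a # cs, q) =
     (let e = neval x q a in
      return_pmf (cs,
        if e \<in> elems x then q\<lparr>rreg := (rreg q)(i := w e), observed := insert e (observed q)\<rparr>
        else q))"
| "step x w (Rand i a # cs, q) =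
     map_pmf (\<lambda>k. (cs, q\<lparr>nreg := (nreg q)(i := k)\<rparr>)) (pmf_of_set {0..neval x q a})"
| "step x w (Seq c d # cs, q) = return_pmf (c # d # cs, q)"
| "step x w (Cond b c d # cs, q) = return_pmf ((if beval x q b then c else d) # cs, q)"
| "step x w (While b c # cs, q) =
     return_pmf (if beval x q b then c # While b c # cs else cs, q)"

definition steps ::
  "matroid_input \<Rightarrow> (nat \<Rightarrow> real) \<Rightarrow> nat \<Rightarrow> com \<Rightarrow> store \<Rightarrow> (com list \<times> store) pmf"
where
  "steps x w t c q = ((\<lambda>d. bind_pmf d (step x w)) ^^ t) (return_pmf ([c], q))"

definition halts_within ::
  "matroid_input \<Rightarrow> (nat \<Rightarrow> real) \<Rightarrow> nat \<Rightarrow> com \<Rightarrow> store \<Rightarrow> bool"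
where
  "halts_within x w t c q \<longleftrightarrow> (\<forall>(cs, q')\<in>set_pmf (steps x w t c q). cs = [])"


section \<open>Polynomial time\<close>

text \<open>A partitioning program leaves the label of element \<open>e\<close> in memory cell \<open>e\<close>: label \<open>0\<close>
  excludes \<open>e\<close> from the ground set, and elements with equal positive labels form a part.\<close>

definition parts :: "matroid_input \<Rightarrow> store \<Rightarrow> nat set set" where
  "parts x q = {{e \<in> elems x. nmem q e = l} | l. 0 < l} - {{}}"

definition polytime_partitioning :: "matroid_input set \<Rightarrow> (matroid_input \<Rightarrow> real) \<Rightarrow> bool" where
  "polytime_partitioning C \<alpha> \<longleftrightarrow>
     (\<exists>(c :: com) (p :: nat poly). \<forall>x\<in>C. \<exists>\<sigma> \<kappa>.
        alpha_partitioning (elems x) (indep x) (\<alpha> x) \<sigma> \<kappa> \<and>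
        (\<forall>w\<in>nonneg_vectors (elems x).
           halts_within x w (poly p (input_size x)) c blank \<and>
           map_pmf (\<lambda>(cs, q). (observed q, parts x q)) (steps x w (poly p (input_size x)) c blank) =
             bind_pmf \<sigma> (\<lambda>S. map_pmf (\<lambda>P. (S, P)) (\<kappa> S (restrict w S)))))"

text \<open>A policy program consists of a preparation part and a part run on each arrival, which
  finds the element and its reward in the registers \<open>0\<close> and accepts iff it leaves a nonzero
  number in register \<open>1\<close>. The samples are read by \<open>Observe\<close>. Each part is run for \<open>t\<close>
  steps; that it halts within them is demanded by \<open>policy_halts\<close>.\<close>

definition arrive :: "nat \<Rightarrow> real \<Rightarrow> store \<Rightarrow> store" where
  "arrive e v q = q\<lparr>nreg := (nreg q)(0 := e), rreg := (rreg q)(0 := v)\<rparr>"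

definition program_policy :: "matroid_input \<Rightarrow> nat \<Rightarrow> com \<Rightarrow> com \<Rightarrow> (nat, store) policy" where
  "program_policy x t c d =
     \<lparr>prep = (\<lambda>s. map_pmf snd (steps x s t c blank)),
      decide = (\<lambda>s q e v.
        map_pmf (\<lambda>(cs, q'). (nreg q' 1 \<noteq> 0, q')) (steps x s t d (arrive e v q)))\<rparr>"

inductive reachable :: "'a set \<Rightarrow> ('a, 'q) policy \<Rightarrow> ('a \<Rightarrow> real) \<Rightarrow> 'a set \<Rightarrow> 'q \<Rightarrow> bool"
  for E :: "'a set" and \<pi> :: "('a, 'q) policy" and s :: "'a \<Rightarrow> real"
where
  initial: "q \<in> set_pmf (prep \<pi> s) \<Longrightarrow> reachable E \<pi> s {} q"
| arrival: "reachable E \<pi> s F q \<Longrightarrow> e \<in> E - F \<Longrightarrow> 0 \<le> v \<Longrightarrow>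
    (b, q') \<in> set_pmf (decide \<pi> s q e v) \<Longrightarrow> reachable E \<pi> s (insert e F) q'"

definition policy_halts :: "matroid_input \<Rightarrow> nat \<Rightarrow> com \<Rightarrow> com \<Rightarrow> bool" where
  "policy_halts x t c d \<longleftrightarrow>
     (\<forall>s\<in>nonneg_vectors (elems x).
        halts_within x s t c blank \<and>
        (\<forall>F q e v. reachable (elems x) (program_policy x t c d) s F q \<and> e \<in> elems x - F \<and> 0 \<le> v
           \<longrightarrow> halts_within x s t d (arrive e v q)))"

end

theory Submission
  imports Defs
begin

text \<open>
  Run the partitioning procedure on the samples and use every part \<open>B\<close> with a single-choice rule:
  accept the first element of \<open>B\<close> whose reward exceeds all samples in \<open>B\<close>. Since only one element
  is taken from each part, the accepted set is independent in the partition matroid.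

  For a single part, condition on the two values of every element, so that only the coins deciding
  which of the two is the reward remain. For a threshold \<open>x\<close>, the rule gains at least \<open>x\<close> unless no
  reward exceeds all samples, which has probability 1/2 by symmetry, or some reward below \<open>x\<close>
  does. In the latter case all samples are below \<open>x\<close>, and exchanging the largest reward below \<open>x\<close>
  with its sample destroys the event, so that it has at most half the probability that all samples
  (equivalently, all rewards) are below \<open>x\<close>. Hence the rule gains at least \<open>x\<close> with at least half
  the probability that some reward is at least \<open>x\<close>, which yields the factor 2.
  The symmetry requires a total order on the values: ties between different elements are broken by a
  numbering of the elements, and ties between the reward and the sample of the same element by a
  fair coin.

  The samples observed by the partitioning procedure and the rewards of the remaining elements have
  the joint law of one weight vector, which brings in the partition property and the factor
  \<open>\<alpha>\<close>.\<close>

section \<open>The threshold rule on a partition\<close>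

text \<open>Strict lexicographic comparison of values with their numbers \<open>idx\<close>. The bit
  \<open>tb\<close> only decides between the reward of \<open>e\<close> and its own sample. With
  \<open>idx\<close> injective on \<open>B\<close>, every comparison of a reward with a sample is
  thus decided, and swapping the two roles while negating \<open>tb\<close> reverses it.\<close>

definition beats :: "('a \<Rightarrow> nat) \<Rightarrow> bool \<Rightarrow> ('a \<Rightarrow> real) \<Rightarrow> 'a set \<Rightarrow> 'a \<Rightarrow> real \<Rightarrow> bool" where
  "beats idx tb s B e v \<longleftrightarrow>
     (\<forall>e'\<in>B. s e' < v \<or> s e' = v \<and> (idx e' < idx e \<or> e' = e \<and> tb))"

text \<open>\<open>P\<close> holds the parts that are still free: deleting the part of an accepted
  element enforces a single choice per part.\<close>

fun threshold_accept ::
  "('a \<Rightarrow> nat) \<Rightarrow> bool \<Rightarrow> 'a set set \<Rightarrow> ('a \<Rightarrow> real) \<Rightarrow> ('a \<Rightarrow> real) \<Rightarrow> 'a list \<Rightarrow> 'a set"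
where
  "threshold_accept idx tb P s r [] = {}"
| "threshold_accept idx tb P s r (e # es) =
     (if \<exists>B\<in>P. e \<in> B \<and> beats idx tb s B e (r e)
      then insert e (threshold_accept idx tb {B \<in> P. e \<notin> B} s r es)
      else threshold_accept idx tb P s r es)"

text \<open>\<open>exchange F s r\<close> and \<open>exchange F r s\<close> are the samples and the
  rewards after every element of \<open>F\<close> has had its two values swapped, so that a uniform
  \<open>F\<close> plays the role of the coins.\<close>

definition exchange :: "'a set \<Rightarrow> ('a \<Rightarrow> real) \<Rightarrow> ('a \<Rightarrow> real) \<Rightarrow> 'a \<Rightarrow> real" where
  "exchange F u v = (\<lambda>e. if e \<in> F then v e else u e)"

text \<open>Symmetric difference with \<open>{e}\<close>: one more swap, at \<open>e\<close>
  alone.\<close>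

definition flip :: "'a set \<Rightarrow> 'a \<Rightarrow> 'a set" where
  "flip F e = {e'. (e' \<in> F) \<noteq> (e' = e)}"

lemma flip_exch:
  "exchange (flip F e) u v e' = (if e' = e then exchange F v u e' else exchange F u v e')"
  by (simp add: exchange_def flip_def)

lemma flip_flip: "flip (flip F e) e = F"
  by (auto simp: flip_def)

lemma flip_subset: "F \<subseteq> U \<Longrightarrow> e \<in> U \<Longrightarrow> flip F e \<subseteq> U"
  by (auto simp: flip_def)

lemma threshold_accept_subset: "threshold_accept idx tb P s r es \<subseteq> \<Union>P \<inter> set es"
proof (induction es arbitrary: P)
  case (Cons e es)
  show ?case using Cons.IH[of P] Cons.IH[of "{B \<in> P. e \<notin> B}"] by auto
qed simp

text \<open>Disjointness decouples the parts: an acceptance outside \<open>B\<close> never deletes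
  \<open>B\<close>, and one inside \<open>B\<close> deletes \<open>B\<close> only. Each part can
  therefore be analysed on its own, as a search for the first element that beats its
  samples.\<close>

lemma threshold_accept_Int_part:
  assumes "disjoint P" "B \<in> P"
  shows "threshold_accept idx tb P s r es \<inter> B =
    set_option (find (\<lambda>e. e \<in> B \<and> beats idx tb s B e (r e)) es)"
  using assms
proof (induction es arbitrary: P)
  case Nil
  then show ?case by simp
next
  case (Cons e es)
  show ?case
  proof (cases "\<exists>B\<in>P. e \<in> B \<and> beats idx tb s B e (r e)")
    case True
    then obtain B' where B': "B' \<in> P" "e \<in> B'" "beats idx tb s B' e (r e)" by blast
    show ?thesis
    proof (cases "e \<in> B")
      case eB: True
      then have "B' = B" using B' Cons.prems by (auto simp: disjoint_def)
      moreover have "threshold_accept idx tb {B \<in> P. e \<notin> B} s r es \<inter> B = {}"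
        using threshold_accept_subset[of idx tb "{B \<in> P. e \<notin> B}" s r es] Cons.prems eB
        by (fastforce simp: disjoint_def)
      ultimately show ?thesis using True B' eB by simp
    next
      case False
      have "disjoint {B \<in> P. e \<notin> B}" using Cons.prems by (auto simp: disjoint_def)
      then show ?thesis using Cons.IH[of "{B \<in> P. e \<notin> B}"] Cons.prems True False by simp
    qed
  next
    case False
    then show ?thesis using Cons.IH[of P] Cons.prems by auto
  qed
qed

lemma lex_max_exists:
  fixes f :: "'a \<Rightarrow> real" and idx :: "'a \<Rightarrow> nat"
  assumes "finite B" "B \<noteq> {}"
  obtains e where "e \<in> B" "\<And>e'. e' \<in> B \<Longrightarrow> f e' < f e \<or> f e' = f e \<and> idx e' \<le> idx e"
proof -
  have "\<exists>e\<in>B. \<forall>e'\<in>B. f e' < f e \<or> f e' = f e \<and> idx e' \<le> idx e"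
    using assms
  proof (induction rule: finite_ne_induct)
    case (singleton e)
    then show ?case by auto
  next
    case (insert a B)
    then obtain e where e: "e \<in> B" "\<forall>e'\<in>B. f e' < f e \<or> f e' = f e \<and> idx e' \<le> idx e" by blast
    show ?case
    proof (cases "f a < f e \<or> f a = f e \<and> idx a \<le> idx e")
      case True
      then show ?thesis using e by auto
    next
      case False
      then have "\<forall>e'\<in>insert a B. f e' < f a \<or> f e' = f a \<and> idx e' \<le> idx a"
        using e(2) by fastforce
      then show ?thesis by blast
    qed
  qed
  then show ?thesis using that by blast
qed

text \<open>The image is as large as \<open>A\<close> and disjoint from it. With \<open>V\<close> as
  the set of outcomes, this turns an injective exchange that destroys an event into the bound 1/2 on
  its probability.\<close>

lemma card_disjoint_image_le:
  assumes "finite V" "A \<subseteq> V" "inj_on f A" "f ` A \<subseteq> V - A"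
  shows "2 * card A \<le> card V"
proof -
  have fin: "finite A" using assms finite_subset by blast
  have "2 * card A = card A + card (f ` A)" using assms by (simp add: card_image)
  also have "\<dots> = card (A \<union> f ` A)"
    using assms(4) fin by (subst card_Un_disjoint) auto
  also have "\<dots> \<le> card V" using assms by (intro card_mono) auto
  finally show ?thesis .
qed

section \<open>Counting exchange patterns within a single part\<close>

context
  fixes U B :: "'a set" and idx :: "'a \<Rightarrow> nat" and s r :: "'a \<Rightarrow> real"
  assumes fin: "finite U" and sub: "B \<subseteq> U" and ne: "B \<noteq> {}" and inj: "inj_on idx B"
begin

abbreviation (input) "smp F \<equiv> exchange F s r"
abbreviation (input) "rew F \<equiv> exchange F r s"

text \<open>Does not involve the arrival order: the rule takes whichever winner comes first, so the
  bounds below speak of all winners at once.\<close>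

definition winners :: "'a set \<Rightarrow> bool \<Rightarrow> 'a set" where
  "winners F tb = {e \<in> B. beats idx tb (smp F) B e (rew F e)}"

lemma exchange_compl: "e \<in> B \<Longrightarrow> exchange (U - F) u v e = exchange F v u e"
  using sub by (auto simp: exchange_def)

text \<open>Complementing \<open>F\<close> and negating \<open>tb\<close> swaps all rewards with all
  samples and reverses every comparison. Whichever is larger, the top reward or the top sample, wins
  before or after the swap, so an outcome without winner is mapped to one with a winner. There are
  \<open>2 * 2 ^ card U\<close> outcomes in all.\<close>

lemma card_no_winner: "card {(F, tb) \<in> Pow U \<times> UNIV. winners F tb = {}} \<le> 2 ^ card U"
proof -
  let ?V = "Pow U \<times> (UNIV :: bool set)"
  let ?N = "{(F, tb) \<in> ?V. winners F tb = {}}"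
  let ?m = "\<lambda>(F, tb). (U - F, \<not> tb)"
  have finB: "finite B" using fin sub finite_subset by blast
  have "winners F tb \<noteq> {} \<or> winners (U - F) (\<not> tb) \<noteq> {}" for F tb
  proof -
    obtain a where a: "a \<in> B"
      "\<And>e'. e' \<in> B \<Longrightarrow> rew F e' < rew F a \<or> rew F e' = rew F a \<and> idx e' \<le> idx a"
      by (rule lex_max_exists[OF finB ne, of "rew F" idx]) blast
    obtain b where b: "b \<in> B"
      "\<And>e'. e' \<in> B \<Longrightarrow> smp F e' < smp F b \<or> smp F e' = smp F b \<and> idx e' \<le> idx b"
      by (rule lex_max_exists[OF finB ne, of "smp F" idx]) blast
    \<comment> \<open>If value and number both tie, injectivity gives \<open>a = b\<close>, and
      \<open>tb\<close> decides.\<close>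
    consider "smp F b < rew F a \<or> smp F b = rew F a \<and> (idx b < idx a \<or> b = a \<and> tb)"
      | "rew F a < smp F b \<or> rew F a = smp F b \<and> (idx a < idx b \<or> a = b \<and> \<not> tb)"
      using inj_onD[OF inj _ a(1) b(1)] by force
    then show ?thesis
    proof cases
      case 1
      have "beats idx tb (smp F) B a (rew F a)"
        unfolding beats_def
      proof
        fix e' assume "e' \<in> B"
        then show "smp F e' < rew F a \<or> smp F e' = rew F a \<and> (idx e' < idx a \<or> e' = a \<and> tb)"
          using b(2)[of e'] 1 inj_onD[OF inj _ b(1), of e'] by force
      qed
      then show ?thesis using a by (auto simp: winners_def)
    next
      case 2
      have "beats idx (\<not> tb) (rew F) B b (smp F b)"
        unfolding beats_def
      proof
        fix e' assume "e' \<in> B"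
        then show "rew F e' < smp F b \<or> rew F e' = smp F b \<and> (idx e' < idx b \<or> e' = b \<and> \<not> tb)"
          using a(2)[of e'] 2 inj_onD[OF inj _ a(1), of e'] by force
      qed
      then have "b \<in> winners (U - F) (\<not> tb)"
        using b(1) by (simp add: winners_def beats_def exchange_compl)
      then show ?thesis by blast
    qed
  qed
  then have "?m ` ?N \<subseteq> ?V - ?N" by auto
  moreover have "inj_on ?m ?N" by (auto simp: inj_on_def)
  ultimately have "2 * card ?N \<le> card ?V"
    using fin by (intro card_disjoint_image_le[of _ _ ?m]) auto
  then show ?thesis using fin by (simp add: card_cartesian_product card_Pow)
qed

text \<open>Exchanging the largest reward below \<open>x\<close> with its sample, and flipping the tie bit, makes
  that reward the largest sample, so that no reward below \<open>x\<close> beats the samples any more.\<close>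

lemma card_low_winner:
  "card {(F, tb) \<in> Pow U \<times> UNIV. \<exists>e\<in>winners F tb. rew F e < x}
     \<le> card {F \<in> Pow U. \<forall>e\<in>B. smp F e < x}"
proof -
  let ?L = "{F \<in> Pow U. \<forall>e\<in>B. smp F e < x}"
  let ?V = "?L \<times> (UNIV :: bool set)"
  let ?N = "{(F, tb) \<in> Pow U \<times> UNIV. \<exists>e\<in>winners F tb. rew F e < x}"
  have finB: "finite B" using fin sub finite_subset by blast
  define top where "top F tb e \<longleftrightarrow> e \<in> B \<and> rew F e < x \<and> beats idx tb (smp F) B e (rew F e) \<and>
    (\<forall>e'\<in>B. rew F e' < x \<longrightarrow> rew F e' < rew F e \<or> rew F e' = rew F e \<and> idx e' \<le> idx e)" for F tb e
  \<comment> \<open>Some reward below \<open>x\<close> beats all samples; the largest reward below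
    \<open>x\<close> is at least as high in the lexicographic order, so it beats them too.\<close>
  have ex: "\<exists>e. top (fst z) (snd z) e" if zN: "z \<in> ?N" for z
  proof -
    obtain F tb where z: "z = (F, tb)" by fastforce
    then obtain e0 where e0: "e0 \<in> B" "beats idx tb (smp F) B e0 (rew F e0)" "rew F e0 < x"
      using zN by (auto simp: winners_def)
    obtain e where e: "e \<in> {e \<in> B. rew F e < x}"
      "\<And>e'. e' \<in> {e \<in> B. rew F e < x} \<Longrightarrow> rew F e' < rew F e \<or> rew F e' = rew F e \<and> idx e' \<le> idx e"
      using finB e0 by (rule_tac lex_max_exists[of "{e \<in> B. rew F e < x}" "rew F" idx]) auto
    have "beats idx tb (smp F) B e (rew F e)"
      unfolding beats_def
    proof
      fix e' assume e': "e' \<in> B"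
      have "rew F e0 < rew F e \<or> rew F e0 = rew F e \<and> idx e0 \<le> idx e" using e(2) e0 by simp
      moreover have "smp F e' < rew F e0 \<or> smp F e' = rew F e0 \<and> (idx e' < idx e0 \<or> e' = e0 \<and> tb)"
        using e0 e' by (auto simp: beats_def)
      moreover have "idx e0 = idx e \<Longrightarrow> e0 = e" using inj e0 e by (auto simp: inj_on_def)
      ultimately show "smp F e' < rew F e \<or> smp F e' = rew F e \<and> (idx e' < idx e \<or> e' = e \<and> tb)"
        by force
    qed
    then show ?thesis using e z by (auto simp: top_def)
  qed
  define t where "t z = (SOME e. top (fst z) (snd z) e)" for z
  have t: "top F tb (t (F, tb))" if "(F, tb) \<in> ?N" for F tb
    using someI_ex[OF ex[OF that]] by (simp add: t_def)
  let ?f = "\<lambda>z. (flip (fst z) (t z), \<not> snd z)"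
  \<comment> \<open>After the exchange the former reward of \<open>t (F, tb)\<close> is the unique
    lexicographically largest sample. This makes the exchanged element recoverable from the
    image.\<close>
  have max: "\<forall>e'\<in>B - {t (F, tb)}. smp (flip F (t (F, tb))) e' < smp (flip F (t (F, tb))) (t (F, tb))
      \<or> smp (flip F (t (F, tb))) e' = smp (flip F (t (F, tb))) (t (F, tb)) \<and> idx e' < idx (t (F, tb))"
    if "(F, tb) \<in> ?N" for F tb
  proof
    fix e' assume e': "e' \<in> B - {t (F, tb)}"
    then have "smp F e' < rew F (t (F, tb)) \<or> smp F e' = rew F (t (F, tb)) \<and> idx e' < idx (t (F, tb))"
      using t[OF that] unfolding top_def beats_def by blast
    then show "smp (flip F (t (F, tb))) e' < smp (flip F (t (F, tb))) (t (F, tb))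
      \<or> smp (flip F (t (F, tb))) e' = smp (flip F (t (F, tb))) (t (F, tb)) \<and> idx e' < idx (t (F, tb))"
      using e' by (simp add: flip_exch)
  qed
  have low: "\<forall>e'\<in>B. smp F e' < x" if "e \<in> winners F tb" "rew F e < x" for F tb e
  proof
    fix e' assume "e' \<in> B"
    then have "smp F e' \<le> rew F e" using that(1) by (auto simp: winners_def beats_def)
    then show "smp F e' < x" using that(2) by simp
  qed
  have NV: "?N \<subseteq> ?V"
  proof
    fix z assume "z \<in> ?N"
    then obtain F tb e where "z = (F, tb)" "F \<subseteq> U" "e \<in> winners F tb" "rew F e < x" by blast
    then show "z \<in> ?V" using low[of e F tb] by simp
  qed
  moreover have "?f ` ?N \<subseteq> ?V - ?N"
  proof (rule image_subsetI)
    fix z assume "z \<in> ?N"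
    then obtain F tb where z: "z = (F, tb)" and N: "(F, tb) \<in> ?N" by blast
    then have a: "F \<subseteq> U" by blast
    let ?e = "t (F, tb)"
    have top: "top F tb ?e" by (rule t[OF N])
    have "\<forall>e\<in>B. smp F e < x" using NV N by blast
    then have "\<forall>e\<in>B. smp (flip F ?e) e < x" using top by (auto simp: flip_exch top_def)
    moreover have "flip F ?e \<subseteq> U" using a top sub by (intro flip_subset) (auto simp: top_def)
    \<comment> \<open>A winner with reward below \<open>x\<close> would have to beat the former
      reward of \<open>?e\<close>, which is now a sample. For \<open>?e\<close> itself this reverses
      the comparison won before, with \<open>tb\<close> negated; for any other element it
      contradicts the maximality of \<open>?e\<close>.\<close>
    moreover have "x \<le> rew (flip F ?e) e" if "e \<in> winners (flip F ?e) (\<not> tb)" for e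
    proof (rule ccontr)
      assume "\<not> ?thesis"
      then have lt: "rew (flip F ?e) e < x" by simp
      from that have e: "e \<in> B" "beats idx (\<not> tb) (smp (flip F ?e)) B e (rew (flip F ?e) e)"
        by (auto simp: winners_def)
      have *: "rew F ?e < rew (flip F ?e) e \<or>
          rew F ?e = rew (flip F ?e) e \<and> (idx ?e < idx e \<or> ?e = e \<and> \<not> tb)"
        using e(2) top by (auto simp: beats_def flip_exch top_def)
      show False
      proof (cases "e = ?e")
        case True
        then have "smp F ?e < rew F ?e \<or> smp F ?e = rew F ?e \<and> tb"
          using top by (auto simp: top_def beats_def)
        then show False using * True by (auto simp: flip_exch)
      next
        case False
        then have "rew F e < rew F ?e \<or> rew F e = rew F ?e \<and> idx e \<le> idx ?e"
          using top lt e(1) by (auto simp: top_def flip_exch)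
        then show False using * False by (auto simp: flip_exch)
      qed
    qed
    ultimately have "(flip F ?e, \<not> tb) \<in> ?V \<and> (flip F ?e, \<not> tb) \<notin> ?N"
      by (simp add: not_less)
    then show "?f z \<in> ?V - ?N" by (simp only: z fst_conv snd_conv Diff_iff) simp
  qed
  moreover have "inj_on ?f ?N"
  proof (rule inj_onI)
    fix z z' assume zz: "z \<in> ?N" "z' \<in> ?N" and eq: "?f z = ?f z'"
    obtain F tb where z: "z = (F, tb)" by (cases z)
    obtain F' tb' where z': "z' = (F', tb')" by (cases z')
    let ?e = "t (F, tb)" and ?e' = "t (F', tb')"
    have G: "flip F ?e = flip F' ?e'" "tb = tb'" using eq unfolding z z' by auto
    have N: "(F, tb) \<in> ?N" "(F', tb') \<in> ?N" using zz by (simp_all only: z z')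
    have B: "?e \<in> B" "?e' \<in> B" using t[OF N(1)] t[OF N(2)] by (simp_all add: top_def)
    \<comment> \<open>Both are the unique largest sample of the same exchanged pattern.\<close>
    have "?e = ?e'"
    proof (rule ccontr)
      assume ne: "?e \<noteq> ?e'"
      show False
        using bspec[OF max[OF N(1)], of ?e'] bspec[OF max[OF N(2)], of ?e] B ne unfolding G(1)
        by auto
    qed
    then have "F = F'" using G flip_flip by metis
    then show "z = z'" using G(2) z z' by simp
  qed
  ultimately have "2 * card ?N \<le> card ?V"
    using fin by (intro card_disjoint_image_le[of _ _ ?f]) auto
  then show ?thesis by (simp add: card_cartesian_product)
qed

text \<open>Remove from all outcomes those without a winner, at most half, and those with a winner
  below \<open>x\<close>, at most as many as the patterns with all samples below \<open>x\<close>.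
  Complementing \<open>F\<close> turns the latter into patterns with all rewards below
  \<open>x\<close>. The right side also ranges over the tie bit, so comparing the two counts amounts
  to comparing probabilities with a factor 1/2.\<close>

lemma card_part_levels:
  "card {F \<in> Pow U. \<exists>e\<in>B. x \<le> rew F e}
     \<le> card {(F, tb) \<in> Pow U \<times> UNIV. winners F tb \<noteq> {} \<and> (\<forall>e\<in>winners F tb. x \<le> rew F e)}"
proof -
  let ?V = "Pow U \<times> (UNIV :: bool set)"
  let ?G = "{(F, tb) \<in> ?V. winners F tb \<noteq> {} \<and> (\<forall>e\<in>winners F tb. x \<le> rew F e)}"
  let ?N = "{(F, tb) \<in> ?V. winners F tb = {}}"
  let ?M = "{(F, tb) \<in> ?V. \<exists>e\<in>winners F tb. rew F e < x}"
  let ?L = "{F \<in> Pow U. \<forall>e\<in>B. smp F e < x}"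
  let ?R = "{F \<in> Pow U. \<forall>e\<in>B. rew F e < x}"
  have eq: "?V = ?G \<union> (?N \<union> ?M)" by (auto simp: not_le)
  have "card ?V \<le> card ?G + card (?N \<union> ?M)" by (subst eq) (rule card_Un_le)
  also have "\<dots> \<le> card ?G + (card ?N + card ?M)" by (intro add_left_mono card_Un_le)
  also have "\<dots> \<le> card ?G + (2 ^ card U + card ?L)"
    by (intro add_left_mono add_mono card_no_winner card_low_winner)
  finally have 1: "2 ^ card U \<le> card ?G + card ?L"
    using fin by (simp add: card_cartesian_product card_Pow)
  have "card ?L = card ?R"
  proof (rule bij_betw_same_card[of "\<lambda>F. U - F"], rule bij_betw_byWitness[of _ "\<lambda>F. U - F"])
    show "(\<lambda>F. U - F) ` ?L \<subseteq> ?R" "(\<lambda>F. U - F) ` ?R \<subseteq> ?L"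
      by (auto simp: exchange_compl)
  qed auto
  moreover have "card ({F \<in> Pow U. \<exists>e\<in>B. x \<le> rew F e} \<union> ?R) =
      card {F \<in> Pow U. \<exists>e\<in>B. x \<le> rew F e} + card ?R"
    using fin by (intro card_Un_disjoint) (auto simp: not_le[symmetric])
  moreover have "{F \<in> Pow U. \<exists>e\<in>B. x \<le> rew F e} \<union> ?R = Pow U"
    by (auto simp: not_less)
  ultimately show ?thesis using 1 fin by (simp add: card_Pow)
qed

end

section \<open>From level counts to sums\<close>

lemma sum_layer_cake:
  fixes h :: "'k \<Rightarrow> real"
  assumes "finite K" "\<And>k. k \<in> K \<Longrightarrow> 0 \<le> h k"
  shows "ennreal (sum h K) =
    (\<integral>\<^sup>+ x. indicator {0<..} x * of_nat (card {k \<in> K. x \<le> h k}) \<partial>lborel)"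
proof -
  have "ennreal (sum h K) = (\<Sum>k\<in>K. \<integral>\<^sup>+ x. indicator {0<..h k} x \<partial>lborel)"
    using assms by (simp add: sum_ennreal)
  also have "\<dots> = (\<integral>\<^sup>+ x. (\<Sum>k\<in>K. indicator {0<..h k} x) \<partial>lborel)"
    by (subst nn_integral_sum) auto
  also have "\<dots> = (\<integral>\<^sup>+ x. indicator {0<..} x * of_nat (card {k \<in> K. x \<le> h k}) \<partial>lborel)"
  proof (intro nn_integral_cong)
    fix x :: real
    have "(\<Sum>k\<in>K. indicator {0<..h k} x :: ennreal) = (\<Sum>k\<in>{k \<in> K. 0 < x \<and> x \<le> h k}. 1)"
      using assms(1) by (intro sum.mono_neutral_cong_right) (auto simp: indicator_def)
    then show "(\<Sum>k\<in>K. indicator {0<..h k} x) =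
        (indicator {0<..} x * of_nat (card {k \<in> K. x \<le> h k}) :: ennreal)"
      by (cases "0 < x") auto
  qed
  finally show ?thesis .
qed

text \<open>Both sums are integrals of their level counts over positive \<open>x\<close>. The index
  sets may differ, as only one side of the comparison will carry the tie bit.\<close>

lemma sum_le_of_card_levels:
  fixes f :: "'i \<Rightarrow> real" and g :: "'j \<Rightarrow> real"
  assumes fin: "finite I" "finite J"
    and nonneg: "\<And>i. i \<in> I \<Longrightarrow> 0 \<le> f i" "\<And>j. j \<in> J \<Longrightarrow> 0 \<le> g j"
    and lev: "\<And>x. 0 < x \<Longrightarrow> card {j \<in> J. x \<le> g j} \<le> card {i \<in> I. x \<le> f i}"
  shows "sum g J \<le> sum f I"
proof -
  have "ennreal (sum g J) \<le> ennreal (sum f I)"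
    using lev
    by (simp only: sum_layer_cake[OF fin(1) nonneg(1)] sum_layer_cake[OF fin(2) nonneg(2)])
       (intro nn_integral_mono, auto simp: indicator_def)
  then show ?thesis
    using nonneg by (simp add: sum_nonneg)
qed

text \<open>The guarantee for one part and fixed pairs of values. In any arrival order some winner
  is accepted if there is one, so the gain reaches \<open>x\<close> whenever winners exist and all
  of them have reward at least \<open>x\<close>. The factor 2 of the theorem is the additional sum
  over \<open>tb\<close>.\<close>

lemma part_sum_le:
  assumes fin: "finite U" and sub: "B \<subseteq> U" and ne: "B \<noteq> {}" and inj: "inj_on idx B"
    and disj: "disjoint P" "B \<in> P" and es: "B \<subseteq> set es"
    and nonneg: "\<And>e. e \<in> B \<Longrightarrow> 0 \<le> s e" "\<And>e. e \<in> B \<Longrightarrow> 0 \<le> r e"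
  shows "(\<Sum>F\<in>Pow U. MAX e\<in>B. exchange F r s e) \<le>
    (\<Sum>(F, tb)\<in>Pow U \<times> UNIV.
       \<Sum>e\<in>threshold_accept idx tb P (exchange F s r) (exchange F r s) es \<inter> B. exchange F r s e)"
proof (rule sum_le_of_card_levels)
  have finB: "finite B" using fin sub finite_subset by blast
  let ?W = "winners B idx s r"
  let ?A = "\<lambda>F tb. threshold_accept idx tb P (exchange F s r) (exchange F r s) es \<inter> B"
  have nn: "0 \<le> exchange F r s e" if "e \<in> B" for e F
    using nonneg that by (auto simp: exchange_def)
  show "finite (Pow U \<times> (UNIV :: bool set))" "finite (Pow U)" using fin by auto
  show "0 \<le> (case z of (F, tb) \<Rightarrow> \<Sum>e\<in>?A F tb. exchange F r s e)" for z
    using nn by (auto intro!: sum_nonneg split: prod.splits)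
  show "0 \<le> (MAX e\<in>B. exchange F r s e)" for F
    using nn ne finB by (subst Max_ge_iff) auto
  fix x :: real assume x: "0 < x"
  have "x \<le> (\<Sum>e\<in>?A F tb. exchange F r s e)"
    if W: "?W F tb \<noteq> {}" "\<forall>e\<in>?W F tb. x \<le> exchange F r s e" for F tb
  proof -
    let ?p = "\<lambda>e. e \<in> B \<and> beats idx tb (exchange F s r) B e (exchange F r s e)"
    have p: "?p e \<longleftrightarrow> e \<in> ?W F tb" for e
      using winners_def[OF fin sub ne inj] by auto
    have "find ?p es \<noteq> None"
      using W(1) es p by (subst find_None_iff) blast
    then obtain e where e: "find ?p es = Some e" by blast
    then have "e \<in> ?W F tb" using p by (auto simp: find_Some_iff)
    moreover have "?A F tb = {e}" using threshold_accept_Int_part[OF disj] e by simp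
    ultimately show ?thesis using W(2) by simp
  qed
  then have "card {(F, tb) \<in> Pow U \<times> UNIV. ?W F tb \<noteq> {} \<and> (\<forall>e\<in>?W F tb. x \<le> exchange F r s e)}
      \<le> card {z \<in> Pow U \<times> UNIV. x \<le> (case z of (F, tb) \<Rightarrow> \<Sum>e\<in>?A F tb. exchange F r s e)}"
    using fin by (intro card_mono) auto
  moreover have "{F \<in> Pow U. x \<le> (MAX e\<in>B. exchange F r s e)} = {F \<in> Pow U. \<exists>e\<in>B. x \<le> exchange F r s e}"
    using finB ne by (auto simp: Max_ge_iff)
  ultimately show "card {F \<in> Pow U. x \<le> (MAX e\<in>B. exchange F r s e)}
      \<le> card {z \<in> Pow U \<times> UNIV. x \<le> (case z of (F, tb) \<Rightarrow> \<Sum>e\<in>?A F tb. exchange F r s e)}"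
    using card_part_levels[OF fin sub ne inj, where s = s and r = r and x = x] by simp
qed

section \<open>Summing over the parts of a partition\<close>

lemma sum_partition:
  assumes "finite P" "\<And>B. B \<in> P \<Longrightarrow> finite B" "disjoint P" "A \<subseteq> \<Union>P"
  shows "sum f A = (\<Sum>B\<in>P. sum f (A \<inter> B))"
proof -
  have "sum f A = sum f (\<Union>B\<in>P. A \<inter> B)" using assms(4) by (intro sum.cong) auto
  also have "\<dots> = (\<Sum>B\<in>P. sum f (A \<inter> B))"
    using assms by (intro sum.UNION_disjoint) (auto simp: disjoint_def)
  finally show ?thesis .
qed

lemma partition_indep_finite: "finite (\<Union>P) \<Longrightarrow> finite (partition_indep P)"
  by (rule finite_subset[of _ "Pow (\<Union>P)"]) (auto simp: partition_indep_def)

text \<open>An independent set takes at most one element from each part, and nonnegativity covers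
  the parts that it misses.\<close>

lemma opt_partition_le:
  assumes P: "partition_on G P" and fin: "finite G" and nonneg: "\<And>e. e \<in> G \<Longrightarrow> 0 \<le> w e"
  shows "opt (partition_indep P) w \<le> (\<Sum>B\<in>P. MAX e\<in>B. w e)"
  unfolding opt_def
proof (rule Max.boundedI)
  have finB: "finite B" "B \<noteq> {}" if "B \<in> P" for B
    using P fin that by (auto simp: partition_on_def intro: finite_subset)
  have G: "\<Union>P = G" and disj: "disjoint P" using P by (auto simp: partition_on_def)
  then have finP: "finite P" using fin finite_UnionD by blast
  show "finite ((\<lambda>T. sum w T) ` partition_indep P)" using partition_indep_finite G fin by auto
  show "(\<lambda>T. sum w T) ` partition_indep P \<noteq> {}" by (auto simp: partition_indep_def)
  fix y assume "y \<in> (\<lambda>T. sum w T) ` partition_indep P"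
  then obtain T where T: "y = sum w T" "T \<subseteq> \<Union>P" "\<forall>B\<in>P. card (T \<inter> B) \<le> 1"
    by (auto simp: partition_indep_def)
  have "y = (\<Sum>B\<in>P. sum w (T \<inter> B))" using sum_partition[OF finP _ disj T(2)] finB T(1) by auto
  also have "\<dots> \<le> (\<Sum>B\<in>P. MAX e\<in>B. w e)"
  proof (rule sum_mono)
    fix B assume B: "B \<in> P"
    show "sum w (T \<inter> B) \<le> (MAX e\<in>B. w e)"
    proof (cases "T \<inter> B = {}")
      case True
      then show ?thesis using finB[OF B] nonneg B G by (auto simp: Max_ge_iff)
    next
      case False
      then have "card (T \<inter> B) = 1"
        using T(3) B finB[OF B] by (meson card_0_eq finite_Int le_antisym less_one linorder_not_le)
      then obtain e where "T \<inter> B = {e}" by (auto simp: card_1_singleton_iff)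
      then show ?thesis using finB[OF B] by (auto intro: Max_ge)
    qed
  qed
  finally show "y \<le> (\<Sum>B\<in>P. MAX e\<in>B. w e)" .
qed

lemma threshold_accept_indep:
  assumes "disjoint P"
  shows "threshold_accept idx tb P s r es \<in> partition_indep P"
proof -
  have "card (threshold_accept idx tb P s r es \<inter> B) \<le> 1" if "B \<in> P" for B
    unfolding threshold_accept_Int_part[OF assms that]
    by (cases "find (\<lambda>e. e \<in> B \<and> beats idx tb s B e (r e)) es") auto
  then show ?thesis using threshold_accept_subset[of idx tb P s r es] by (auto simp: partition_indep_def)
qed

text \<open>Adds up \<open>part_sum_le\<close> over the parts. The set \<open>U\<close> of
  exchangeable elements may exceed the ground set \<open>G\<close>; it will be the complement of the
  observed set.\<close>

lemma opt_partition_le_threshold_accept: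
  assumes P: "partition_on G P" and sub: "G \<subseteq> U" and fin: "finite U" and inj: "inj_on idx U"
    and es: "G \<subseteq> set es" and nonneg: "\<And>e. e \<in> U \<Longrightarrow> 0 \<le> s e" "\<And>e. e \<in> U \<Longrightarrow> 0 \<le> r e"
  shows "(\<Sum>F\<in>Pow U. opt (partition_indep P) (exchange F r s)) \<le>
    (\<Sum>F\<in>Pow U. \<Sum>tb\<in>UNIV.
       \<Sum>e\<in>threshold_accept idx tb P (exchange F s r) (exchange F r s) es. exchange F r s e)"
proof -
  have finG: "finite G" using fin sub finite_subset by blast
  have B: "finite B" "B \<noteq> {}" "B \<subseteq> G" if "B \<in> P" for B
    using P finG that by (auto simp: partition_on_def intro: finite_subset)
  have G: "\<Union>P = G" and disj: "disjoint P" using P by (auto simp: partition_on_def)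
  then have finP: "finite P" using finG finite_UnionD by blast
  let ?A = "\<lambda>F tb. threshold_accept idx tb P (exchange F s r) (exchange F r s) es"
  have "(\<Sum>F\<in>Pow U. opt (partition_indep P) (exchange F r s)) \<le>
      (\<Sum>F\<in>Pow U. \<Sum>B\<in>P. MAX e\<in>B. exchange F r s e)"
    using nonneg sub by (intro sum_mono opt_partition_le[OF P finG]) (auto simp: exchange_def)
  also have "\<dots> = (\<Sum>B\<in>P. \<Sum>F\<in>Pow U. MAX e\<in>B. exchange F r s e)" by (rule sum.swap)
  also have "\<dots> \<le> (\<Sum>B\<in>P. \<Sum>(F, tb)\<in>Pow U \<times> UNIV. \<Sum>e\<in>?A F tb \<inter> B. exchange F r s e)"
  proof (rule sum_mono)
    fix B' assume B': "B' \<in> P"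
    have "B' \<subseteq> U" "B' \<subseteq> set es" using B(3)[OF B'] sub es by auto
    then show "(\<Sum>F\<in>Pow U. MAX e\<in>B'. exchange F r s e)
        \<le> (\<Sum>(F, tb)\<in>Pow U \<times> UNIV. \<Sum>e\<in>?A F tb \<inter> B'. exchange F r s e)"
      using nonneg inj B(2)[OF B']
      by (intro part_sum_le[OF fin _ _ _ disj B']) (auto intro: inj_on_subset)
  qed
  also have "\<dots> = (\<Sum>(F, tb)\<in>Pow U \<times> UNIV. \<Sum>B\<in>P. \<Sum>e\<in>?A F tb \<inter> B. exchange F r s e)"
    by (subst sum.swap) (simp add: case_prod_unfold)
  also have "\<dots> = (\<Sum>(F, tb)\<in>Pow U \<times> UNIV. \<Sum>e\<in>?A F tb. exchange F r s e)"
  proof (intro sum.cong refl, clarsimp)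
    fix F tb
    have "?A F tb \<subseteq> \<Union>P" using threshold_accept_subset by fast
    then show "(\<Sum>B\<in>P. \<Sum>e\<in>?A F tb \<inter> B. exchange F r s e) = (\<Sum>e\<in>?A F tb. exchange F r s e)"
      using sum_partition[OF finP B(1) disj, where A = "?A F tb" and f = "exchange F r s"] by simp
  qed
  also have "\<dots> = (\<Sum>F\<in>Pow U. \<Sum>tb\<in>UNIV. \<Sum>e\<in>?A F tb. exchange F r s e)"
    by (simp add: sum.cartesian_product)
  finally show ?thesis .
qed

section \<open>Exchanging samples and rewards\<close>

definition exchange_pair :: "'a set \<Rightarrow> ('a \<Rightarrow> real) \<times> ('a \<Rightarrow> real) \<Rightarrow> ('a \<Rightarrow> real) \<times> ('a \<Rightarrow> real)" where
  "exchange_pair F z = (exchange F (fst z) (snd z), exchange F (snd z) (fst z))"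

lemma measurable_exchange:
  assumes f: "f \<in> measurable N (PiM E D)" and g: "g \<in> measurable N (PiM E D)"
  shows "(\<lambda>z. exchange F (f z) (g z)) \<in> measurable N (PiM E D)"
  unfolding exchange_def
proof (rule measurable_PiM_single')
  fix e assume e: "e \<in> E"
  show "(\<lambda>z. if e \<in> F then g z e else f z e) \<in> measurable N (D e)"
    using measurable_compose[OF f measurable_component_singleton[OF e]]
      measurable_compose[OF g measurable_component_singleton[OF e]]
    by (cases "e \<in> F") auto
next
  show "(\<lambda>z e. if e \<in> F then g z e else f z e) \<in> space N \<rightarrow> (\<Pi>\<^sub>E e\<in>E. space (D e))"
    using measurable_space[OF f] measurable_space[OF g]
    by (fastforce simp: space_PiM PiE_iff extensional_def)
qed

lemma measurable_exchange_pair: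
  "exchange_pair F \<in> measurable (PiM E D \<Otimes>\<^sub>M PiM E D) (PiM E D \<Otimes>\<^sub>M PiM E D)"
  unfolding exchange_pair_def[abs_def] by (auto intro!: measurable_Pair measurable_exchange)

text \<open>Both sides are images of the product measure on \<open>E <+> E\<close>, which is determined by its
  values on boxes; exchanging coordinates permutes the factors of a box.\<close>

lemma distr_exchange_pair:
  fixes D :: "'a \<Rightarrow> real measure"
  assumes fin: "finite E" and prob: "\<And>e. e \<in> E \<Longrightarrow> prob_space (D e)" and F: "F \<subseteq> E"
  shows "distr (PiM E D \<Otimes>\<^sub>M PiM E D) (PiM E D \<Otimes>\<^sub>M PiM E D) (exchange_pair F) = PiM E D \<Otimes>\<^sub>M PiM E D"
proof -
  \<comment> \<open>The product locale asks for a probability measure at every index; outside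
    \<open>E\<close> a point mass at 0 is put in.\<close>
  define D' where "D' e = (if e \<in> E then D e else return borel 0)" for e
  have [simp]: "PiM E D = PiM E D'" by (rule PiM_cong) (auto simp: D'_def)
  have D': "prob_space (D' e)" for e
    using prob by (auto simp: D'_def intro: prob_space_return)
  interpret D': product_prob_space D' E by (rule product_prob_spaceI) (rule D')
  interpret P: prob_space "PiM E D'" by (rule prob_space_PiM) (rule D')
  interpret PP: pair_prob_space "PiM E D'" "PiM E D'" by standard
  let ?M = "PiM E D' \<Otimes>\<^sub>M PiM E D'"
  define DD where "DD = case_sum D' D'"
  interpret DD: product_prob_space DD "E <+> E"
    by (rule product_prob_spaceI) (auto simp: DD_def D' split: sum.split)
  let ?Q = "PiM (E <+> E) DD"
  define \<phi> where "\<phi> z = (\<lambda>i\<in>E <+> E. case i of Inl e \<Rightarrow> fst z e | Inr e \<Rightarrow> snd z e)"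
    for z :: "('a \<Rightarrow> real) \<times> ('a \<Rightarrow> real)"
  define \<psi> where "\<psi> f = ((\<lambda>e\<in>E. f (Inl e)), (\<lambda>e\<in>E. f (Inr e)))" for f :: "'a + 'a \<Rightarrow> real"
  have \<phi>: "\<phi> \<in> measurable ?M ?Q"
    unfolding \<phi>_def
  proof (rule measurable_restrict)
    fix i assume "i \<in> E <+> E"
    then show "(\<lambda>z. case i of Inl e \<Rightarrow> fst z e | Inr e \<Rightarrow> snd z e) \<in> measurable ?M (DD i)"
      by (auto simp: DD_def intro!: measurable_compose[OF measurable_fst] measurable_compose[OF measurable_snd]
          measurable_component_singleton)
  qed
  have comp: "(\<lambda>f. f i) \<in> measurable ?Q (D' e)" if "i \<in> E <+> E" "DD i = D' e" for i e
    using measurable_component_singleton[OF that(1), of DD] that(2) by simp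
  have \<psi>: "\<psi> \<in> measurable ?Q ?M"
    unfolding \<psi>_def by (intro measurable_Pair measurable_restrict comp) (auto simp: DD_def)
  have T: "exchange_pair G \<in> measurable ?M ?M" for G by (rule measurable_exchange_pair)
  \<comment> \<open>The preimage of a box is again a product of two boxes, with the factors at the
    elements of \<open>G\<close> swapped between them. Its measure is the same product of numbers
    for every \<open>G\<close>.\<close>
  have Q: "distr ?M ?Q (\<phi> \<circ> exchange_pair G) = ?Q" if "G \<subseteq> E" for G
  proof (rule DD.PiM_eqI)
    show "finite (E <+> E)" using fin by simp
    show "sets (distr ?M ?Q (\<phi> \<circ> exchange_pair G)) = sets ?Q" by simp
    fix A assume A: "\<And>i. i \<in> E <+> E \<Longrightarrow> A i \<in> sets (DD i)"
    let ?A1 = "\<lambda>e. if e \<in> G then A (Inr e) else A (Inl e)"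
    let ?A2 = "\<lambda>e. if e \<in> G then A (Inl e) else A (Inr e)"
    have A12: "?A1 e \<in> sets (D' e)" "?A2 e \<in> sets (D' e)" if "e \<in> E" for e
      using A[of "Inl e"] A[of "Inr e"] that by (auto simp: DD_def)
    have "(\<phi> \<circ> exchange_pair G) -` PiE (E <+> E) A \<inter> space ?M = PiE E ?A1 \<times> PiE E ?A2" (is "?L = ?R")
    proof (intro set_eqI iffI)
      fix z assume "z \<in> ?L"
      then have "fst z \<in> extensional E" "snd z \<in> extensional E"
        and *: "\<And>i. i \<in> E <+> E \<Longrightarrow> \<phi> (exchange_pair G z) i \<in> A i"
        by (auto simp: space_pair_measure space_PiM PiE_def Pi_def)
      moreover have "fst z e \<in> ?A1 e" "snd z e \<in> ?A2 e" if "e \<in> E" for e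
        using *[OF InlI[OF that]] *[OF InrI[OF that]] that
        by (auto simp: \<phi>_def exchange_pair_def exchange_def split: if_splits)
      ultimately have "fst z \<in> PiE E ?A1" "snd z \<in> PiE E ?A2" unfolding PiE_iff by blast+
      then show "z \<in> ?R" by (simp add: mem_Times_iff)
    next
      fix z assume "z \<in> ?R"
      then have z: "fst z \<in> PiE E ?A1" "snd z \<in> PiE E ?A2" by (simp_all add: mem_Times_iff)
      then have "fst z e \<in> ?A1 e" "snd z e \<in> ?A2 e" if "e \<in> E" for e using that by (simp_all only: PiE_iff)
      note z12 = this
      have "fst z \<in> space (PiM E D')" "snd z \<in> space (PiM E D')"
        using z A12[THEN sets.sets_into_space] unfolding space_PiM PiE_iff by blast+
      then have "z \<in> space ?M" by (simp add: space_pair_measure mem_Times_iff)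
      moreover have "\<phi> (exchange_pair G z) i \<in> A i" if "i \<in> E <+> E" for i
        using that z12(1)[of "projl i"] z12(2)[of "projl i"] z12(1)[of "projr i"] z12(2)[of "projr i"]
        by (auto simp: \<phi>_def exchange_pair_def exchange_def split: if_splits)
      moreover have "\<phi> (exchange_pair G z) \<in> extensional (E <+> E)" by (simp add: \<phi>_def)
      ultimately show "z \<in> ?L" by (simp add: PiE_iff)
    qed
    then have "emeasure (distr ?M ?Q (\<phi> \<circ> exchange_pair G)) (PiE (E <+> E) A) = emeasure ?M (PiE E ?A1 \<times> PiE E ?A2)"
      using fin A by (subst emeasure_distr) (auto intro!: measurable_comp[OF T \<phi>] sets_PiM_I_finite)
    also have "\<dots> = emeasure (PiM E D') (PiE E ?A1) * emeasure (PiM E D') (PiE E ?A2)"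
      using fin A12 by (intro sigma_finite_measure.emeasure_pair_measure_Times[OF prob_space_imp_sigma_finite[OF prob_space_PiM]] sets_PiM_I_finite) (auto intro: D')
    also have "\<dots> = (\<Prod>e\<in>E. emeasure (D' e) (?A1 e)) * (\<Prod>e\<in>E. emeasure (D' e) (?A2 e))"
      using fin A12 by (simp only: D'.emeasure_PiM)
    also have "\<dots> = (\<Prod>e\<in>E. emeasure (D' e) (A (Inl e)) * emeasure (D' e) (A (Inr e)))"
      unfolding prod.distrib[symmetric] by (rule prod.cong) (auto simp: mult.commute)
    also have "\<dots> = (\<Prod>i\<in>E <+> E. emeasure (DD i) (A i))"
      using fin by (simp add: prod.Plus prod.distrib DD_def comp_def)
    finally show "emeasure (distr ?M ?Q (\<phi> \<circ> exchange_pair G)) (PiE (E <+> E) A) =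
      (\<Prod>i\<in>E <+> E. emeasure (DD i) (A i))" .
  qed
  have inverse: "\<psi> (\<phi> z) = z" if "z \<in> space ?M" for z
    using that by (cases z) (auto simp: \<phi>_def \<psi>_def space_pair_measure space_PiM PiE_def extensional_def fun_eq_iff)
  have "distr ?M ?M (exchange_pair G) = distr ?Q ?M \<psi>" if "G \<subseteq> E" for G
  proof -
    have "distr ?Q ?M \<psi> = distr (distr ?M ?Q (\<phi> \<circ> exchange_pair G)) ?M \<psi>" by (simp only: Q[OF that])
    also have "\<dots> = distr ?M ?M (\<psi> \<circ> (\<phi> \<circ> exchange_pair G))"
      by (rule distr_distr[OF \<psi> measurable_comp[OF T \<phi>]])
    also have "\<dots> = distr ?M ?M (exchange_pair G)"
      using inverse measurable_space[OF T] by (intro distr_cong) auto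
    finally show ?thesis by simp
  qed
  \<comment> \<open>The image measure does not depend on \<open>G\<close>, and \<open>G = {}\<close>
    gives the identity.\<close>
  from this[OF F] this[of "{}"]
  have "distr ?M ?M (exchange_pair F) = distr ?M ?M (exchange_pair {})" by simp
  also have "\<dots> = ?M" by (subst distr_cong[of ?M ?M ?M ?M _ "\<lambda>z. z"]) (auto simp: exchange_pair_def exchange_def)
  finally show ?thesis by simp
qed

lemma nn_integral_exchange_pair:
  fixes D :: "'a \<Rightarrow> real measure"
  assumes "finite E" "\<And>e. e \<in> E \<Longrightarrow> prob_space (D e)" "F \<subseteq> E"
    and f: "f \<in> borel_measurable (PiM E D \<Otimes>\<^sub>M PiM E D)"
  shows "(\<integral>\<^sup>+ z. f (exchange_pair F z) \<partial>(PiM E D \<Otimes>\<^sub>M PiM E D)) = integral\<^sup>N (PiM E D \<Otimes>\<^sub>M PiM E D) f"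
proof -
  have "integral\<^sup>N (PiM E D \<Otimes>\<^sub>M PiM E D) f =
      integral\<^sup>N (distr (PiM E D \<Otimes>\<^sub>M PiM E D) (PiM E D \<Otimes>\<^sub>M PiM E D) (exchange_pair F)) f"
    by (simp only: distr_exchange_pair[OF assms(1-3)])
  also have "\<dots> = (\<integral>\<^sup>+ z. f (exchange_pair F z) \<partial>(PiM E D \<Otimes>\<^sub>M PiM E D))"
    using f by (intro nn_integral_distr measurable_exchange_pair) auto
  finally show ?thesis by simp
qed

section \<open>Competitiveness\<close>

lemma space_nonneg_borel: "space nonneg_borel = {0..}"
  by (simp add: nonneg_borel_def space_restrict_space)

lemma space_nonneg_vectors: "space (PiM S (\<lambda>_. nonneg_borel)) = nonneg_vectors S"
  by (simp add: space_PiM space_nonneg_borel nonneg_vectors_def)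

lemma borel_measurable_coordinate:
  assumes "e \<in> E"
  shows "(\<lambda>v. v e) \<in> borel_measurable (PiM E (\<lambda>_. nonneg_borel))"
proof -
  have "(\<lambda>x. x) \<in> borel_measurable nonneg_borel"
    unfolding nonneg_borel_def by (rule measurable_restrict_space1) simp
  then show ?thesis by (rule measurable_compose[OF measurable_component_singleton[OF assms]])
qed

lemma nonneg_vectors_nonneg: "v \<in> nonneg_vectors E \<Longrightarrow> e \<in> E \<Longrightarrow> 0 \<le> v e"
  by (auto simp: nonneg_vectors_def)

lemma restrict_nonneg_vectors: "v \<in> nonneg_vectors E \<Longrightarrow> S \<subseteq> E \<Longrightarrow> restrict v S \<in> nonneg_vectors S"
  by (auto simp: nonneg_vectors_def)

lemma exchange_nonneg_vectors:
  "u \<in> nonneg_vectors E \<Longrightarrow> v \<in> nonneg_vectors E \<Longrightarrow> exchange F u v \<in> nonneg_vectors E"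
  by (auto simp: nonneg_vectors_def exchange_def PiE_iff extensional_def)

section \<open>Measurability of accepted sets and optima\<close>

lemma measurable_threshold_accept:
  assumes fin: "finite E" and P: "\<Union>P \<subseteq> E" and es: "set es \<subseteq> E"
    and s: "\<And>e. e \<in> E \<Longrightarrow> (\<lambda>z. s z e) \<in> borel_measurable N"
    and r: "\<And>e. e \<in> E \<Longrightarrow> (\<lambda>z. r z e) \<in> borel_measurable N"
  shows "(\<lambda>z. threshold_accept idx tb P (s z) (r z) es) \<in> measurable N (count_space UNIV)"
  using P es
proof (induction es arbitrary: P)
  case Nil
  then show ?case by simp
next
  case (Cons e es)
  have finP: "finite P" using fin Cons.prems(1) by (meson finite_UnionD finite_subset)
  have eE: "e \<in> E" using Cons.prems by simp
  have pred: "Measurable.pred N (\<lambda>z. \<exists>B\<in>P. e \<in> B \<and> beats idx tb (s z) B e (r z e))"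
  proof (rule pred_intros_finite(4)[OF finP])
    fix B assume B: "B \<in> P"
    then have BE: "B \<subseteq> E" using Cons.prems by auto
    have "Measurable.pred N (\<lambda>z. beats idx tb (s z) B e (r z e))"
      unfolding beats_def
    proof (rule pred_intros_finite(3))
      show "finite B" using BE fin finite_subset by blast
      fix e' assume "e' \<in> B"
      then have e': "e' \<in> E" using BE by auto
      note [measurable] = s[OF e'] r[OF eE]
      show "Measurable.pred N (\<lambda>z. s z e' < r z e \<or> s z e' = r z e \<and> (idx e' < idx e \<or> e' = e \<and> tb))"
        by measurable
    qed
    then show "Measurable.pred N (\<lambda>z. e \<in> B \<and> beats idx tb (s z) B e (r z e))"
      by (intro pred_intros_logic) auto
  qed
  have "(\<lambda>z. threshold_accept idx tb {B \<in> P. e \<notin> B} (s z) (r z) es) \<in> measurable N (count_space UNIV)"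
    using Cons.prems by (intro Cons.IH) auto
  then have "(\<lambda>z. insert e (threshold_accept idx tb {B \<in> P. e \<notin> B} (s z) (r z) es)) \<in> measurable N (count_space UNIV)"
    by (rule measurable_compose) simp
  moreover have "(\<lambda>z. threshold_accept idx tb P (s z) (r z) es) \<in> measurable N (count_space UNIV)"
    using Cons.prems by (intro Cons.IH) auto
  ultimately show ?case
    unfolding threshold_accept.simps using pred by (intro measurable_If) auto
qed

lemma borel_measurable_opt:
  assumes "finite I" "\<And>T e. T \<in> I \<Longrightarrow> e \<in> T \<Longrightarrow> (\<lambda>z. w z e) \<in> borel_measurable N"
  shows "(\<lambda>z. opt I (w z)) \<in> borel_measurable N"
  unfolding opt_def using assms by (intro borel_measurable_Max borel_measurable_sum) auto

text \<open>The range of summation can be chosen independently of the weights on which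
  \<open>p\<close> depends, so that measurability in the weights can be checked summand by
  summand.\<close>

lemma nn_integral_pmf_superset:
  assumes "set_pmf p \<subseteq> X" "finite X"
  shows "(\<integral>\<^sup>+ x. f x \<partial>measure_pmf p) = (\<Sum>x\<in>X. ennreal (pmf p x) * f x)"
proof -
  have "(\<integral>\<^sup>+ x. f x \<partial>measure_pmf p) = (\<Sum>x\<in>set_pmf p. f x * pmf p x)"
    using assms by (intro nn_integral_measure_pmf_finite) (auto intro: finite_subset)
  also have "\<dots> = (\<Sum>x\<in>X. ennreal (pmf p x) * f x)"
    using assms by (intro sum.mono_neutral_cong_left) (auto simp: set_pmf_iff mult.commute)
  finally show ?thesis .
qed

text \<open>The reference law: it is shown to be valid and competitive, and both the abstract policy
  and the program are shown to realize it.\<close>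

definition threshold_law ::
  "('a \<Rightarrow> nat) \<Rightarrow> 'a set pmf \<Rightarrow> ('a set \<Rightarrow> ('a \<Rightarrow> real) \<Rightarrow> 'a set set pmf) \<Rightarrow> 'a list \<Rightarrow>
    ('a \<Rightarrow> real) \<Rightarrow> ('a \<Rightarrow> real) \<Rightarrow> 'a set pmf"
where
  "threshold_law idx \<sigma> \<kappa> es s r =
     bind_pmf \<sigma> (\<lambda>S. bind_pmf (\<kappa> S (restrict s S))
       (\<lambda>P. map_pmf (\<lambda>tb. threshold_accept idx tb P s r es) (pmf_of_set UNIV)))"

section \<open>The partition property as an inequality of finite sums\<close>

lemma opt_nonneg: "finite I \<Longrightarrow> {} \<in> I \<Longrightarrow> 0 \<le> opt I w"
  unfolding opt_def by (subst Max_ge_iff) (auto intro: bexI[of _ "{}"])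

text \<open>The numbering \<open>idx\<close> breaks ties; it is an arbitrary injection for the
  abstract policy and \<open>id\<close> for programs.\<close>

locale partitioned_matroid =
  fixes E :: "'a set" and I :: "'a set set" and \<alpha> :: real and \<sigma> :: "'a set pmf"
    and \<kappa> :: "'a set \<Rightarrow> ('a \<Rightarrow> real) \<Rightarrow> 'a set set pmf" and idx :: "'a \<Rightarrow> nat"
  assumes matroid: "matroid E I" and alpha: "1 \<le> \<alpha>"
    and partitioning: "alpha_partitioning E I \<alpha> \<sigma> \<kappa>" and inj: "inj_on idx E"
begin

lemma finite_ground: "finite E" and indep_subset: "I \<subseteq> Pow E"
  using matroid unfolding matroid_def by simp_all

lemma finite_indep: "finite I"
  using finite_ground indep_subset by (simp add: finite_subset)

lemma observed_subset: "S \<in> set_pmf \<sigma> \<Longrightarrow> S \<subseteq> E"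
  using partitioning unfolding alpha_partitioning_def by (elim conjE) blast

lemma kernel_measurable:
  assumes "S \<in> set_pmf \<sigma>"
  shows "(\<lambda>v. pmf (\<kappa> S v) P) \<in> borel_measurable (PiM S (\<lambda>_. nonneg_borel))"
  using partitioning assms unfolding alpha_partitioning_def by metis

lemma kernel_partition:
  assumes "S \<in> set_pmf \<sigma>" "v \<in> nonneg_vectors S" "P \<in> set_pmf (\<kappa> S v)"
  shows "\<exists>E'\<subseteq>E - S. partition_on E' P" "partition_indep P \<subseteq> I"
proof -
  have "\<forall>S\<in>set_pmf \<sigma>. \<forall>v\<in>nonneg_vectors S. \<forall>P\<in>set_pmf (\<kappa> S v).
      (\<exists>E'\<subseteq>E - S. partition_on E' P) \<and> partition_indep P \<subseteq> I"
    using partitioning unfolding alpha_partitioning_def by simp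
  from bspec[OF bspec[OF bspec[OF this assms(1)] assms(2)] assms(3)] show "\<exists>E'\<subseteq>E - S. partition_on E' P" "partition_indep P \<subseteq> I" by simp_all
qed

lemma finite_observed: "finite (set_pmf \<sigma>)"
proof (rule finite_subset)
  show "set_pmf \<sigma> \<subseteq> Pow E" using observed_subset by (simp add: subset_iff)
qed (simp add: finite_ground)

lemma kernel_support:
  assumes "S \<in> set_pmf \<sigma>" "v \<in> nonneg_vectors S"
  shows "set_pmf (\<kappa> S v) \<subseteq> Pow (Pow E)"
proof
  fix P assume "P \<in> set_pmf (\<kappa> S v)"
  then obtain E' where "E' \<subseteq> E - S" "partition_on E' P" using kernel_partition(1)[OF assms] by blast
  then show "P \<in> Pow (Pow E)" by (auto simp: partition_on_def)
qed

lemma nn_integral_partitioning: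
  assumes "w \<in> nonneg_vectors E"
  shows "(\<integral>\<^sup>+ S. (\<integral>\<^sup>+ P. h S P \<partial>measure_pmf (\<kappa> S (restrict w S))) \<partial>measure_pmf \<sigma>) =
    (\<Sum>S\<in>set_pmf \<sigma>. ennreal (pmf \<sigma> S) *
      (\<Sum>P\<in>Pow (Pow E). ennreal (pmf (\<kappa> S (restrict w S)) P) * h S P))"
proof -
  have "(\<integral>\<^sup>+ P. h S P \<partial>measure_pmf (\<kappa> S (restrict w S))) =
      (\<Sum>P\<in>Pow (Pow E). ennreal (pmf (\<kappa> S (restrict w S)) P) * h S P)" if "S \<in> set_pmf \<sigma>" for S
    using that kernel_support restrict_nonneg_vectors[OF assms] observed_subset finite_ground
    by (intro nn_integral_pmf_superset) auto
  then show ?thesis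
    using finite_observed by (subst nn_integral_pmf_superset[of \<sigma> "set_pmf \<sigma>"]) auto
qed

lemma nn_integral_threshold_law:
  assumes "s \<in> nonneg_vectors E"
  shows "(\<integral>\<^sup>+ A. h A \<partial>measure_pmf (threshold_law idx \<sigma> \<kappa> es s r)) =
    (\<Sum>S\<in>set_pmf \<sigma>. ennreal (pmf \<sigma> S) *
      (\<Sum>P\<in>Pow (Pow E). ennreal (pmf (\<kappa> S (restrict s S)) P) *
        ((\<Sum>tb\<in>UNIV. h (threshold_accept idx tb P s r es)) / 2)))"
  unfolding threshold_law_def nn_integral_bind_pmf nn_integral_map_pmf
  by (simp add: nn_integral_partitioning[OF assms] nn_integral_pmf_of_set)

text \<open>Transfers the partition property from Bochner expectations to \<open>ennreal\<close>;
  the finite support of the mixture supplies integrability.\<close>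

lemma opt_partitioning_le:
  assumes "w \<in> nonneg_vectors E"
  shows "ennreal (1 / \<alpha>) * ennreal (opt I w) \<le>
    (\<Sum>S\<in>set_pmf \<sigma>. ennreal (pmf \<sigma> S) *
      (\<Sum>P\<in>Pow (Pow E). ennreal (pmf (\<kappa> S (restrict w S)) P) * ennreal (opt (partition_indep P) w)))"
proof -
  let ?p = "bind_pmf \<sigma> (\<lambda>S. \<kappa> S (restrict w S))"
  have sup: "set_pmf ?p \<subseteq> Pow (Pow E)"
  proof
    fix P assume "P \<in> set_pmf ?p"
    then obtain S where S: "S \<in> set_pmf \<sigma>" "P \<in> set_pmf (\<kappa> S (restrict w S))" by auto
    then show "P \<in> Pow (Pow E)"
      using kernel_support[OF S(1) restrict_nonneg_vectors[OF assms observed_subset]] by blast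
  qed
  have fin: "finite (set_pmf ?p)" using sup finite_ground by (auto intro: finite_subset)
  have nonneg: "0 \<le> opt (partition_indep P) w" if "P \<in> set_pmf ?p" for P
  proof (rule opt_nonneg)
    have "\<Union>P \<subseteq> E" using that sup by auto
    then show "finite (partition_indep P)"
      using finite_ground by (meson finite_subset partition_indep_finite)
  qed (auto simp: partition_indep_def)
  have "1 / \<alpha> * opt I w \<le> measure_pmf.expectation ?p (\<lambda>P. opt (partition_indep P) w)"
    using partitioning assms by (auto simp: alpha_partitioning_def)
  then have "ennreal (1 / \<alpha> * opt I w) \<le> ennreal (measure_pmf.expectation ?p (\<lambda>P. opt (partition_indep P) w))"
    by (rule ennreal_leI)
  also have "\<dots> = (\<integral>\<^sup>+ P. ennreal (opt (partition_indep P) w) \<partial>measure_pmf ?p)"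
    using nonneg by (intro nn_integral_eq_integral[symmetric] integrable_measure_pmf_finite fin AE_pmfI)
  also have "\<dots> = (\<Sum>S\<in>set_pmf \<sigma>. ennreal (pmf \<sigma> S) *
      (\<Sum>P\<in>Pow (Pow E). ennreal (pmf (\<kappa> S (restrict w S)) P) * ennreal (opt (partition_indep P) w)))"
    by (simp add: nn_integral_bind_pmf nn_integral_partitioning[OF assms])
  finally show ?thesis using alpha by (subst ennreal_mult'[symmetric]) auto
qed

section \<open>Validity and measurability of the reference law\<close>

abbreviation (input) "vecs \<equiv> PiM E (\<lambda>_. nonneg_borel)"

lemma measurable_partition_weight:
  assumes S: "S \<in> set_pmf \<sigma>" and f: "f \<in> measurable N vecs"
  shows "(\<lambda>z. ennreal (pmf (\<kappa> S (restrict (f z) S)) P)) \<in> borel_measurable N"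
  by (intro measurable_compose[OF f] measurable_compose[OF measurable_restrict_subset[OF observed_subset[OF S]]]
      measurable_compose[OF kernel_measurable[OF S]]) simp

lemma measurable_count_threshold_accept:
  assumes "P \<subseteq> Pow E" "set es \<subseteq> E"
  shows "(\<lambda>z. threshold_accept idx tb P (fst z) (snd z) es) \<in> measurable (vecs \<Otimes>\<^sub>M vecs) (count_space UNIV)"
  using assms finite_ground
  by (intro measurable_threshold_accept[of E] measurable_compose[OF measurable_fst]
      measurable_compose[OF measurable_snd] borel_measurable_coordinate) auto

lemma threshold_law_indep:
  assumes "s \<in> nonneg_vectors E"
  shows "set_pmf (threshold_law idx \<sigma> \<kappa> es s r) \<subseteq> I"
proof
  fix A assume "A \<in> set_pmf (threshold_law idx \<sigma> \<kappa> es s r)"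
  then obtain S P tb where *: "S \<in> set_pmf \<sigma>" "P \<in> set_pmf (\<kappa> S (restrict s S))"
    "A = threshold_accept idx tb P s r es"
    by (auto simp: threshold_law_def)
  have v: "restrict s S \<in> nonneg_vectors S" using restrict_nonneg_vectors assms observed_subset * by blast
  have "disjoint P" using kernel_partition(1)[OF *(1) v *(2)] by (auto simp: partition_on_def)
  then have "A \<in> partition_indep P" using threshold_accept_indep * by blast
  then show "A \<in> I" using kernel_partition(2)[OF *(1) v *(2)] by blast
qed

text \<open>The mass at \<open>A\<close> is the integral of the indicator of \<open>{A}\<close>,
  hence a finite sum of kernel weights times indicators of accepted sets.\<close>

lemma threshold_law_measurable:
  assumes es: "set es \<subseteq> E"
  shows "(\<lambda>(s, r). pmf (threshold_law idx \<sigma> \<kappa> es s r) A) \<in> borel_measurable (vecs \<Otimes>\<^sub>M vecs)"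
proof -
  let ?H = "\<lambda>z. (\<Sum>S\<in>set_pmf \<sigma>. ennreal (pmf \<sigma> S) *
      (\<Sum>P\<in>Pow (Pow E). ennreal (pmf (\<kappa> S (restrict (fst z) S)) P) *
        ((\<Sum>tb\<in>UNIV. indicator {A} (threshold_accept idx tb P (fst z) (snd z) es)) / 2)))"
  have "(\<lambda>z. indicator {A} (threshold_accept idx tb P (fst z) (snd z) es) :: ennreal)
      \<in> borel_measurable (vecs \<Otimes>\<^sub>M vecs)" if "P \<in> Pow (Pow E)" for tb P
    using that es by (intro measurable_compose[OF measurable_count_threshold_accept]) auto
  then have "?H \<in> borel_measurable (vecs \<Otimes>\<^sub>M vecs)"
    by (intro borel_measurable_sum borel_measurable_times_ennreal borel_measurable_const
        measurable_partition_weight measurable_fst borel_measurable_divide_ennreal) auto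
  then have "(\<lambda>z. enn2real (?H z)) \<in> borel_measurable (vecs \<Otimes>\<^sub>M vecs)" by simp
  moreover have "pmf (threshold_law idx \<sigma> \<kappa> es s r) A = enn2real (?H (s, r))"
    if "(s, r) \<in> space (vecs \<Otimes>\<^sub>M vecs)" for s r
  proof -
    have "s \<in> nonneg_vectors E" using that by (simp add: space_pair_measure space_nonneg_vectors)
    then have "?H (s, r) = (\<integral>\<^sup>+ B. indicator {A} B \<partial>measure_pmf (threshold_law idx \<sigma> \<kappa> es s r))"
      by (subst nn_integral_threshold_law) simp_all
    then show ?thesis by (simp add: emeasure_pmf_single)
  qed
  ultimately show ?thesis by (subst measurable_cong[where g = "\<lambda>z. enn2real (?H z)"]) auto
qed

lemma borel_measurable_reward: "e \<in> E \<Longrightarrow> (\<lambda>z. snd z e) \<in> borel_measurable (vecs \<Otimes>\<^sub>M vecs)"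
  by (rule measurable_compose[OF measurable_snd borel_measurable_coordinate])

lemma measurable_part_opt:
  assumes "P \<in> Pow (Pow E)"
  shows "(\<lambda>z. ennreal (opt (partition_indep P) (snd z))) \<in> borel_measurable (vecs \<Otimes>\<^sub>M vecs)"
proof -
  have "\<Union>P \<subseteq> E" using assms by auto
  then have "finite (partition_indep P)" "\<And>T e. T \<in> partition_indep P \<Longrightarrow> e \<in> T \<Longrightarrow> e \<in> E"
    using finite_subset[OF _ finite_ground] partition_indep_finite unfolding partition_indep_def by blast+
  then have "(\<lambda>z. opt (partition_indep P) (snd z)) \<in> borel_measurable (vecs \<Otimes>\<^sub>M vecs)"
    by (intro borel_measurable_opt borel_measurable_reward)
  then show ?thesis by simp
qed

lemma measurable_part_gain:
  assumes "P \<in> Pow (Pow E)" "arrival_order E es"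
  shows "(\<lambda>z. ennreal (sum (snd z) (threshold_accept idx tb P (fst z) (snd z) es)))
      \<in> borel_measurable (vecs \<Otimes>\<^sub>M vecs)"
proof -
  have "\<Union>P \<subseteq> E" using assms by auto
  then have sub: "threshold_accept idx tb P s r es \<in> Pow E" for s r
    using threshold_accept_subset[of idx tb P s r es] by blast
  have ta: "(\<lambda>z. threshold_accept idx tb P (fst z) (snd z) es) \<in> measurable (vecs \<Otimes>\<^sub>M vecs) (count_space UNIV)"
    using assms by (intro measurable_count_threshold_accept) (auto simp: arrival_order_def)
  \<comment> \<open>The accepted set varies with \<open>z\<close>, so the gain is written as a sum
    over the fixed set \<open>E\<close> with indicators of acceptance.\<close>
  have eq: "sum (snd z) (threshold_accept idx tb P (fst z) (snd z) es) =
      (\<Sum>e\<in>E. indicator {A. e \<in> A} (threshold_accept idx tb P (fst z) (snd z) es) * snd z e)" for z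
    using sub[of "fst z" "snd z"] finite_ground
    by (intro sum.mono_neutral_cong_left) (auto simp: indicator_def)
  have "(\<lambda>z. sum (snd z) (threshold_accept idx tb P (fst z) (snd z) es)) \<in> borel_measurable (vecs \<Otimes>\<^sub>M vecs)"
    unfolding eq by (intro borel_measurable_sum borel_measurable_times borel_measurable_reward measurable_compose[OF ta]) auto
  then show ?thesis by simp
qed

section \<open>The competitive ratio\<close>

abbreviation (input) "wt S P v \<equiv> ennreal (pmf (\<kappa> S (restrict v S)) P)"

text \<open>Averaging over all exchanges of samples and rewards outside \<open>S\<close> leaves the law of the
  partition unchanged; exchanging inside \<open>S\<close> then turns the observed samples and the remaining
  rewards into a single weight vector.\<close>

lemma observed_competitive:
  fixes D :: "'a \<Rightarrow> real measure"
  assumes D: "\<And>e. e \<in> E \<Longrightarrow> prob_space (D e)" "\<And>e. e \<in> E \<Longrightarrow> sets (D e) = sets nonneg_borel"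
    and es: "arrival_order E es" and S: "S \<in> set_pmf \<sigma>"
  defines "N \<equiv> PiM E D \<Otimes>\<^sub>M PiM E D"
  shows "(\<integral>\<^sup>+ z. (\<Sum>P\<in>Pow (Pow E). wt S P (snd z) * ennreal (opt (partition_indep P) (snd z))) \<partial>N)
    \<le> 2 * (\<integral>\<^sup>+ z. (\<Sum>P\<in>Pow (Pow E). wt S P (fst z) *
          ((\<Sum>tb\<in>UNIV. ennreal (sum (snd z) (threshold_accept idx tb P (fst z) (snd z) es))) / 2)) \<partial>N)"
    (is "integral\<^sup>N N ?O \<le> 2 * integral\<^sup>N N ?K")
proof -
  have SE: "S \<subseteq> E" using observed_subset[OF S] .
  let ?U = "E - S"
  \<comment> \<open>In \<open>?O'\<close> the partition comes from the samples, as in the policy,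
    and is evaluated at the rewards; in \<open>?O\<close> a single weight vector serves for
    both.\<close>
  let ?O' = "\<lambda>z. \<Sum>P\<in>Pow (Pow E). wt S P (fst z) * ennreal (opt (partition_indep P) (snd z))"
  have setsD: "sets (PiM E D) = sets vecs" using D(2) by (intro sets_PiM_cong) auto
  then have setsN: "sets N = sets (vecs \<Otimes>\<^sub>M vecs)" unfolding N_def by (intro sets_pair_measure_cong)
  have spaceN: "fst z \<in> nonneg_vectors E" "snd z \<in> nonneg_vectors E" if "z \<in> space N" for z
  proof -
    have "z \<in> nonneg_vectors E \<times> nonneg_vectors E"
      using that unfolding sets_eq_imp_space_eq[OF setsN] space_pair_measure space_nonneg_vectors .
    then show "fst z \<in> nonneg_vectors E" "snd z \<in> nonneg_vectors E" by (simp_all add: mem_Times_iff)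
  qed
  have mK: "?K \<in> borel_measurable N"
    unfolding measurable_cong_sets[OF setsN refl]
    using measurable_part_gain es by (intro borel_measurable_sum borel_measurable_times_ennreal borel_measurable_divide_ennreal
        borel_measurable_const measurable_partition_weight[OF S] measurable_fst) auto
  have mO': "?O' \<in> borel_measurable N"
    unfolding measurable_cong_sets[OF setsN refl]
    using measurable_part_opt by (intro borel_measurable_sum borel_measurable_times_ennreal
        measurable_partition_weight[OF S] measurable_fst) auto
  \<comment> \<open>The partition only sees the first vector on \<open>S\<close>, which exchanges
    outside \<open>S\<close> leave alone.\<close>
  have restr: "restrict (exchange F u v) S = restrict u S" if "F \<subseteq> ?U" for F and u v :: "'a \<Rightarrow> real"
    using that by (auto simp: exchange_def fun_eq_iff)
  have int_exch: "(\<integral>\<^sup>+ z. f (exchange_pair F z) \<partial>N) = integral\<^sup>N N f"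
    if "F \<subseteq> E" "f \<in> borel_measurable N" for F f
    using that finite_ground D(1) unfolding N_def by (intro nn_integral_exchange_pair) auto
  have meas_exch: "(\<lambda>z. f (exchange_pair F z)) \<in> borel_measurable N" if "f \<in> borel_measurable N" for f :: "_ \<Rightarrow> ennreal" and F
    using measurable_compose[OF measurable_exchange_pair[of F E D], of f borel] that unfolding N_def .
  \<comment> \<open>For a fixed pair of vectors, the patterns \<open>F\<close> act as the coins. The
    weight of \<open>P\<close> is the same for all of them, which reduces the claim to a fixed
    partition.\<close>
  have pointwise: "(\<Sum>F\<in>Pow ?U. ?O' (exchange_pair F z)) \<le> (\<Sum>F\<in>Pow ?U. 2 * ?K (exchange_pair F z))"
    if z: "z \<in> space N" for z
  proof -
    let ?s = "\<lambda>F. fst (exchange_pair F z)" and ?r = "\<lambda>F. snd (exchange_pair F z)"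
    have *: "wt S P (fst z) * (\<Sum>F\<in>Pow ?U. ennreal (opt (partition_indep P) (?r F))) \<le>
        wt S P (fst z) * (\<Sum>F\<in>Pow ?U. \<Sum>tb\<in>UNIV. ennreal (sum (?r F) (threshold_accept idx tb P (?s F) (?r F) es)))"
      for P
    \<comment> \<open>Off the support \<open>P\<close> need not be a partition, but its weight is
      0.\<close>
    proof (cases "P \<in> set_pmf (\<kappa> S (restrict (fst z) S))")
      case False
      then show ?thesis by (simp add: set_pmf_iff)
    next
      case True
      obtain G where G: "G \<subseteq> E - S" "partition_on G P"
        using kernel_partition(1)[OF S restrict_nonneg_vectors[OF spaceN(1)[OF z] SE] True] by blast
      have PE: "\<Union>P \<subseteq> E" using G by (auto simp: partition_on_def)
      have nn: "0 \<le> sum (?r F) (threshold_accept idx tb P (?s F) (?r F) es)" for F tb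
        using PE threshold_accept_subset[of idx tb P "?s F" "?r F" es] spaceN[OF z]
        by (intro sum_nonneg nonneg_vectors_nonneg[of _ E])
           (auto simp: exchange_pair_def intro: exchange_nonneg_vectors)
      have nn': "0 \<le> opt (partition_indep P) (?r F)" for F
        using finite_subset[OF PE finite_ground]
        by (intro opt_nonneg partition_indep_finite) (simp_all add: partition_indep_def)
      have "(\<Sum>F\<in>Pow ?U. opt (partition_indep P) (?r F)) \<le>
          (\<Sum>F\<in>Pow ?U. \<Sum>tb\<in>UNIV. sum (?r F) (threshold_accept idx tb P (?s F) (?r F) es))"
        unfolding exchange_pair_def fst_conv snd_conv
        using G finite_ground inj es spaceN[OF z]
        by (intro opt_partition_le_threshold_accept[OF G(2) G(1)])
           (auto simp: arrival_order_def intro: inj_on_subset nonneg_vectors_nonneg)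
      then have "ennreal (\<Sum>F\<in>Pow ?U. opt (partition_indep P) (?r F)) \<le>
          ennreal (\<Sum>F\<in>Pow ?U. \<Sum>tb\<in>UNIV. sum (?r F) (threshold_accept idx tb P (?s F) (?r F) es))"
        by (rule ennreal_leI)
      then show ?thesis
        using nn nn' by (intro mult_left_mono) (simp_all add: sum_ennreal sum_nonneg)
    qed
    have "(\<Sum>F\<in>Pow ?U. ?O' (exchange_pair F z)) =
        (\<Sum>F\<in>Pow ?U. \<Sum>P\<in>Pow (Pow E). wt S P (fst z) * ennreal (opt (partition_indep P) (?r F)))"
      by (intro sum.cong refl) (simp add: exchange_pair_def restr)
    also have "\<dots> = (\<Sum>P\<in>Pow (Pow E). wt S P (fst z) * (\<Sum>F\<in>Pow ?U. ennreal (opt (partition_indep P) (?r F))))"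
      by (subst sum.swap) (simp only: sum_distrib_left)
    also have "\<dots> \<le> (\<Sum>P\<in>Pow (Pow E). wt S P (fst z) *
        (\<Sum>F\<in>Pow ?U. \<Sum>tb\<in>UNIV. ennreal (sum (?r F) (threshold_accept idx tb P (?s F) (?r F) es))))"
      using * by (rule sum_mono)
    also have "\<dots> = (\<Sum>F\<in>Pow ?U. \<Sum>P\<in>Pow (Pow E). wt S P (fst z) *
        (\<Sum>tb\<in>UNIV. ennreal (sum (?r F) (threshold_accept idx tb P (?s F) (?r F) es))))"
      by (subst sum.swap) (simp only: sum_distrib_left)
    also have "\<dots> = (\<Sum>F\<in>Pow ?U. 2 * ?K (exchange_pair F z))"
    proof (intro sum.cong refl)
      fix F assume "F \<in> Pow ?U"
      then have "restrict (?s F) S = restrict (fst z) S" by (simp add: exchange_pair_def restr)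
      \<comment> \<open>The factor 2 cancels the averaging over the tie bit.\<close>
      moreover have "2 * (a * (b / 2)) = a * b" for a b :: ennreal
        using ennreal_mult_divide_eq[of 2 "a * b"] by (simp add: ennreal_times_divide mult.commute)
      ultimately show "(\<Sum>P\<in>Pow (Pow E). wt S P (fst z) *
          (\<Sum>tb\<in>UNIV. ennreal (sum (?r F) (threshold_accept idx tb P (?s F) (?r F) es)))) = 2 * ?K (exchange_pair F z)"
        by (simp only: sum_distrib_left[of 2])
    qed
    finally show ?thesis .
  qed
  have "integral\<^sup>N N ?O = (\<integral>\<^sup>+ z. ?O' (exchange_pair S z) \<partial>N)"
  proof (intro nn_integral_cong sum.cong refl)
    fix z P assume z: "z \<in> space N" "P \<in> Pow (Pow E)"
    have r: "restrict (fst (exchange_pair S z)) S = restrict (snd z) S"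
      by (auto simp: exchange_pair_def exchange_def fun_eq_iff)
    show "wt S P (snd z) * ennreal (opt (partition_indep P) (snd z)) =
      wt S P (fst (exchange_pair S z)) * ennreal (opt (partition_indep P) (snd (exchange_pair S z)))"
    proof (cases "P \<in> set_pmf (\<kappa> S (restrict (snd z) S))")
      case False
      then show ?thesis unfolding r by (simp add: set_pmf_iff)
    next
      case True
      obtain G where "G \<subseteq> E - S" "partition_on G P"
        using kernel_partition(1)[OF S restrict_nonneg_vectors[OF spaceN(2)[OF z(1)] SE] True] by blast
      then have "\<Union>P \<inter> S = {}" by (auto simp: partition_on_def)
      \<comment> \<open>All parts avoid \<open>S\<close>, so an exchange inside \<open>S\<close>
        does not touch the weights that enter the optimum.\<close>
      then have "opt (partition_indep P) (snd (exchange_pair S z)) = opt (partition_indep P) (snd z)"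
        unfolding opt_def
        by (intro arg_cong[where f = Max] image_cong refl sum.cong)
           (auto simp: partition_indep_def exchange_pair_def exchange_def)
      then show ?thesis unfolding r by simp
    qed
  qed
  also have "\<dots> = integral\<^sup>N N ?O'" by (rule int_exch[OF SE mO'])
  finally have O: "integral\<^sup>N N ?O = integral\<^sup>N N ?O'" .
  let ?c = "of_nat (card (Pow ?U)) :: ennreal"
  have avg: "?c * integral\<^sup>N N f = (\<integral>\<^sup>+ z. (\<Sum>F\<in>Pow ?U. f (exchange_pair F z)) \<partial>N)"
    if "f \<in> borel_measurable N" for f :: "_ \<Rightarrow> ennreal"
  proof -
    have "(\<integral>\<^sup>+ z. (\<Sum>F\<in>Pow ?U. f (exchange_pair F z)) \<partial>N) = (\<Sum>F\<in>Pow ?U. \<integral>\<^sup>+ z. f (exchange_pair F z) \<partial>N)"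
      using that meas_exch by (intro nn_integral_sum) auto
    also have "\<dots> = (\<Sum>F\<in>Pow ?U. integral\<^sup>N N f)"
      using that by (intro sum.cong refl int_exch) auto
    finally show ?thesis by simp
  qed
  have "?c * integral\<^sup>N N ?O' \<le> ?c * (\<integral>\<^sup>+ z. 2 * ?K z \<partial>N)"
    unfolding avg[OF mO'] avg[OF borel_measurable_times_ennreal[OF borel_measurable_const mK]]
    by (intro nn_integral_mono pointwise)
  \<comment> \<open>The number of patterns is positive and finite, so it cancels in
    \<open>ennreal\<close>.\<close>
  then have "integral\<^sup>N N ?O' \<le> (\<integral>\<^sup>+ z. 2 * ?K z \<partial>N)"
    using finite_ground by (subst (asm) ennreal_mult_le_mult_iff) (auto simp: card_gt_0_iff)
  then show ?thesis unfolding O nn_integral_cmult[OF mK] .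
qed

text \<open>The partition property is applied pointwise to the reward vector, which costs
  \<open>\<alpha>\<close>. Then \<open>observed_competitive\<close> is applied to each observed set
  \<open>S\<close> of the finite mixture, which costs 2.\<close>

lemma threshold_law_competitive:
  fixes D :: "'a \<Rightarrow> real measure"
  assumes D: "\<And>e. e \<in> E \<Longrightarrow> prob_space (D e)" "\<And>e. e \<in> E \<Longrightarrow> sets (D e) = sets nonneg_borel"
    and es: "arrival_order E es"
  shows "(\<integral>\<^sup>+ r. ennreal (opt I r) \<partial>PiM E D) \<le> ennreal (2 * \<alpha>) *
    (\<integral>\<^sup>+ (s, r). (\<integral>\<^sup>+ A. ennreal (\<Sum>e\<in>A. r e) \<partial>measure_pmf (threshold_law idx \<sigma> \<kappa> es s r))
      \<partial>(PiM E D \<Otimes>\<^sub>M PiM E D))"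
proof -
  let ?N = "PiM E D \<Otimes>\<^sub>M PiM E D"
  let ?O = "\<lambda>S z. \<Sum>P\<in>Pow (Pow E). wt S P (snd z) * ennreal (opt (partition_indep P) (snd z))"
  let ?K = "\<lambda>S z. \<Sum>P\<in>Pow (Pow E). wt S P (fst z) *
      ((\<Sum>tb\<in>UNIV. ennreal (sum (snd z) (threshold_accept idx tb P (fst z) (snd z) es))) / 2)"
  have setsD: "sets (PiM E D) = sets vecs" using D(2) by (intro sets_PiM_cong) auto
  then have setsN: "sets ?N = sets (vecs \<Otimes>\<^sub>M vecs)" by (intro sets_pair_measure_cong)
  have spaceN: "fst z \<in> nonneg_vectors E" "snd z \<in> nonneg_vectors E" if "z \<in> space ?N" for z
  proof -
    have "z \<in> nonneg_vectors E \<times> nonneg_vectors E"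
      using that unfolding space_pair_measure sets_eq_imp_space_eq[OF setsD] space_nonneg_vectors .
    then show "fst z \<in> nonneg_vectors E" "snd z \<in> nonneg_vectors E" by (simp_all add: mem_Times_iff)
  qed
  interpret P: prob_space "PiM E D" by (rule prob_space_PiM) (rule D(1))
  have mopt: "(\<lambda>r. ennreal (opt I r)) \<in> borel_measurable (PiM E D)"
  proof -
    have "(\<lambda>r. opt I r) \<in> borel_measurable vecs"
      using finite_indep indep_subset by (intro borel_measurable_opt borel_measurable_coordinate) auto
    then show ?thesis unfolding measurable_cong_sets[OF setsD refl] by simp
  qed
  have mO: "?O S \<in> borel_measurable ?N" and mK: "?K S \<in> borel_measurable ?N" if "S \<in> set_pmf \<sigma>" for S
    unfolding measurable_cong_sets[OF setsN refl]
    using measurable_part_opt measurable_part_gain es that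
    by (intro borel_measurable_sum borel_measurable_times_ennreal borel_measurable_divide_ennreal
        borel_measurable_const measurable_partition_weight measurable_fst measurable_snd; auto)+
  have "(\<integral>\<^sup>+ r. ennreal (opt I r) \<partial>PiM E D) = (\<integral>\<^sup>+ z. ennreal (opt I (snd z)) \<partial>?N)"
    using mopt P.emeasure_space_1 by (subst P.nn_integral_fst[symmetric]) auto
  also have "\<dots> = ennreal \<alpha> * (\<integral>\<^sup>+ z. ennreal (1 / \<alpha>) * ennreal (opt I (snd z)) \<partial>?N)"
    using mopt alpha by (subst nn_integral_cmult) (auto simp: mult.assoc[symmetric] ennreal_mult[symmetric])
  also have "\<dots> \<le> ennreal \<alpha> * (\<integral>\<^sup>+ z. (\<Sum>S\<in>set_pmf \<sigma>. ennreal (pmf \<sigma> S) * ?O S z) \<partial>?N)"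
    by (intro mult_left_mono nn_integral_mono opt_partitioning_le spaceN) auto
  also have "\<dots> = ennreal \<alpha> * (\<Sum>S\<in>set_pmf \<sigma>. ennreal (pmf \<sigma> S) * integral\<^sup>N ?N (?O S))"
    using mO by (simp add: nn_integral_sum nn_integral_cmult)
  also have "\<dots> \<le> ennreal \<alpha> * (\<Sum>S\<in>set_pmf \<sigma>. ennreal (pmf \<sigma> S) * (2 * integral\<^sup>N ?N (?K S)))"
    using D es by (intro mult_left_mono sum_mono observed_competitive) auto
  also have "\<dots> = ennreal (2 * \<alpha>) * (\<Sum>S\<in>set_pmf \<sigma>. ennreal (pmf \<sigma> S) * integral\<^sup>N ?N (?K S))"
    using alpha by (simp add: sum_distrib_left ennreal_mult mult_ac)
  also have "\<dots> = ennreal (2 * \<alpha>) * (\<integral>\<^sup>+ z. (\<Sum>S\<in>set_pmf \<sigma>. ennreal (pmf \<sigma> S) * ?K S z) \<partial>?N)"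
    using mK by (simp add: nn_integral_sum nn_integral_cmult)
  also have "\<dots> = ennreal (2 * \<alpha>) * (\<integral>\<^sup>+ (s, r).
      (\<integral>\<^sup>+ A. ennreal (\<Sum>e\<in>A. r e) \<partial>measure_pmf (threshold_law idx \<sigma> \<kappa> es s r)) \<partial>?N)"
    using spaceN by (intro arg_cong2[where f = "(*)"] refl nn_integral_cong)
       (simp add: nn_integral_threshold_law case_prod_beta)
  finally show ?thesis .
qed

text \<open>Reduces both properties to identifying the law of the accepted set. The memory type is
  left open to serve the abstract policy as well as programs.\<close>

lemma valid_and_competitive:
  fixes \<pi> :: "('a, 'q) policy"
  assumes acc: "\<And>es s r. arrival_order E es \<Longrightarrow> s \<in> nonneg_vectors E \<Longrightarrow> r \<in> nonneg_vectors E \<Longrightarrow>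
    accepted \<pi> es s r = threshold_law idx \<sigma> \<kappa> es s r"
  shows "valid_policy E I \<pi> \<and> competitive (2 * \<alpha>) E I \<pi>"
proof
  show "valid_policy E I \<pi>"
    unfolding valid_policy_def
  proof (intro allI impI conjI ballI)
    fix es assume es: "arrival_order E es"
    show "set_pmf (accepted \<pi> es s r) \<subseteq> I" if "s \<in> nonneg_vectors E" "r \<in> nonneg_vectors E" for s r
      using threshold_law_indep[OF that(1)] acc[OF es that] by simp
    fix A
    have eq: "(case z of (s, r) \<Rightarrow> pmf (accepted \<pi> es s r) A) =
        (case z of (s, r) \<Rightarrow> pmf (threshold_law idx \<sigma> \<kappa> es s r) A)" if "z \<in> space (vecs \<Otimes>\<^sub>M vecs)" for z
      using that acc[OF es] unfolding space_pair_measure space_nonneg_vectors by auto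
    have "(\<lambda>(s, r). pmf (threshold_law idx \<sigma> \<kappa> es s r) A) \<in> borel_measurable (vecs \<Otimes>\<^sub>M vecs)"
      using es by (intro threshold_law_measurable) (simp add: arrival_order_def)
    then show "(\<lambda>(s, r). pmf (accepted \<pi> es s r) A) \<in> borel_measurable (vecs \<Otimes>\<^sub>M vecs)"
      by (rule measurable_cong[THEN iffD2, rotated]) (rule eq)
  qed
next
  show "competitive (2 * \<alpha>) E I \<pi>"
    unfolding competitive_def
  proof (intro allI impI)
    fix D :: "'a \<Rightarrow> real measure" and es
    assume D: "\<forall>e\<in>E. prob_space (D e) \<and> sets (D e) = sets nonneg_borel" and es: "arrival_order E es"
    let ?N = "PiM E D \<Otimes>\<^sub>M PiM E D"
    have "sets (PiM E D) = sets vecs" using D by (intro sets_PiM_cong) auto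
    from sets_eq_imp_space_eq[OF this] have space: "space ?N = nonneg_vectors E \<times> nonneg_vectors E"
      by (simp add: space_pair_measure space_nonneg_vectors)
    have "(\<integral>\<^sup>+ (s, r). (\<integral>\<^sup>+ A. ennreal (\<Sum>e\<in>A. r e) \<partial>measure_pmf (accepted \<pi> es s r)) \<partial>?N) =
      (\<integral>\<^sup>+ (s, r). (\<integral>\<^sup>+ A. ennreal (\<Sum>e\<in>A. r e) \<partial>measure_pmf (threshold_law idx \<sigma> \<kappa> es s r)) \<partial>?N)"
      using acc[OF es] by (intro nn_integral_cong) (auto simp: space)
    then show "(\<integral>\<^sup>+ r. ennreal (opt I r) \<partial>PiM E D) \<le> ennreal (2 * \<alpha>) *
        (\<integral>\<^sup>+ (s, r). (\<integral>\<^sup>+ A. ennreal (\<Sum>e\<in>A. r e) \<partial>measure_pmf (accepted \<pi> es s r)) \<partial>?N)"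
      using threshold_law_competitive[of D es] D es by simp
  qed
qed

end

section \<open>Executions of programs\<close>

text \<open>Extends \<open>steps\<close> to arbitrary configurations, since executing a command
  leaves a list of pending ones.\<close>

definition run :: "matroid_input \<Rightarrow> (nat \<Rightarrow> real) \<Rightarrow> nat \<Rightarrow> com list \<times> store \<Rightarrow> (com list \<times> store) pmf" where
  "run x w t cfg = ((\<lambda>d. bind_pmf d (step x w)) ^^ t) (return_pmf cfg)"

lemma steps_eq_run: "steps x w t c q = run x w t ([c], q)"
  by (simp add: steps_def run_def)

lemma run_0: "run x w 0 cfg = return_pmf cfg"
  by (simp add: run_def)

lemma funpow_bind_pmf:
  fixes f :: "'b \<Rightarrow> 'b pmf"
  shows "((\<lambda>d. bind_pmf d f) ^^ t) (bind_pmf M g) = bind_pmf M (\<lambda>a. ((\<lambda>d. bind_pmf d f) ^^ t) (g a))"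
  by (induction t) (simp_all add: bind_assoc_pmf)

text \<open>By definition the next step is appended at the end; reasoning about programs needs the
  first step split off instead.\<close>

lemma run_Suc: "run x w (Suc t) cfg = bind_pmf (step x w cfg) (run x w t)"
proof -
  have "run x w (Suc t) cfg = ((\<lambda>d. bind_pmf d (step x w)) ^^ t) (bind_pmf (step x w cfg) return_pmf)"
    unfolding run_def funpow_Suc_right comp_apply bind_return_pmf bind_return_pmf' ..
  then show ?thesis unfolding funpow_bind_pmf run_def .
qed

text \<open>Includes termination: after \<open>t\<close> steps no command is pending in any outcome.
  As halted configurations idle, \<open>t\<close> is only an upper bound on the running
  time.\<close>

definition computes ::
  "matroid_input \<Rightarrow> (nat \<Rightarrow> real) \<Rightarrow> nat \<Rightarrow> com list \<Rightarrow> store \<Rightarrow> store pmf \<Rightarrow> bool"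
where
  "computes x w t cs q \<mu> \<longleftrightarrow> run x w t (cs, q) = map_pmf (Pair []) \<mu>"

lemma computes_Nil: "computes x w t [] q (return_pmf q)"
  unfolding computes_def by (induction t) (simp_all add: run_0 run_Suc bind_return_pmf)

lemma computes_NilD:
  assumes "computes x w t [] q \<mu>"
  shows "\<mu> = return_pmf q"
proof -
  have "map_pmf (Pair []) \<mu> = map_pmf (Pair ([] :: com list)) (return_pmf q)"
    using assms computes_Nil[of x w t q] unfolding computes_def by simp
  then have "map_pmf snd (map_pmf (Pair ([] :: com list)) \<mu>) = map_pmf snd (map_pmf (Pair ([] :: com list)) (return_pmf q))"
    by simp
  then show ?thesis by (simp add: map_pmf_comp)
qed

lemma computes_step:
  assumes "step x w (cs, q) = return_pmf (cs', q')" "computes x w t cs' q' \<mu>"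
  shows "computes x w (Suc t) cs q \<mu>"
  using assms by (simp add: computes_def run_Suc bind_return_pmf)

lemma step_append:
  "cs \<noteq> [] \<Longrightarrow> step x w (cs @ ds, q) = map_pmf (\<lambda>(k, q'). (k @ ds, q')) (step x w (cs, q))"
  by (cases "(x, w, (cs, q))" rule: step.cases) (auto simp: Let_def map_pmf_comp)

text \<open>Random outcomes may exhaust \<open>cs\<close> at different times. The induction splits
  off one step at a time; once \<open>cs\<close> is exhausted, its remaining time is spent idling
  after \<open>ds\<close>.\<close>

lemma computes_append:
  assumes "computes x w t cs q \<mu>" "\<And>q'. q' \<in> set_pmf \<mu> \<Longrightarrow> computes x w u ds q' (\<nu> q')"
  shows "computes x w (t + u) (cs @ ds) q (bind_pmf \<mu> \<nu>)"
  using assms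
proof (induction t arbitrary: cs q \<mu>)
  case 0
  have "set_pmf (map_pmf (Pair []) \<mu>) = {(cs, q)}"
    using 0(1) by (simp add: computes_def run_0 flip: set_return_pmf)
  then have "cs = []" by (metis (no_types, lifting) fst_conv image_iff insertI1 pmf.set_map)
  then show ?case using 0 computes_NilD by (fastforce simp: bind_return_pmf)
next
  case (Suc t)
  show ?case
  proof (cases "cs = []")
    case True
    then have \<mu>: "\<mu> = return_pmf q" using computes_NilD Suc.prems(1) by blast
    \<comment> \<open>\<open>ds\<close> halts within \<open>u\<close> steps and idles for the
      surplus \<open>k\<close>.\<close>
    have mono: "computes x w (k + u) ds q (\<nu> q)" for k
    proof -
      have "run x w (k + u) (ds, q) = bind_pmf (run x w u (ds, q)) (run x w k)" for k
      proof (induction u arbitrary: ds q)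
        case 0
        then show ?case by (simp add: run_0 bind_return_pmf)
      next
        case (Suc u)
        then show ?case
          by (simp add: run_Suc bind_assoc_pmf) (intro bind_pmf_cong refl, auto)
      qed
      moreover have "run x w k ([], q') = return_pmf ([], q')" for q'
        using computes_Nil[of x w k q'] by (simp add: computes_def)
      ultimately show ?thesis
        using Suc.prems(2)[of q] by (simp add: \<mu> computes_def bind_map_pmf map_pmf_def[symmetric])
    qed
    show ?thesis using True mono[of "Suc t"] by (simp add: \<mu> bind_return_pmf)
  next
    case False
    have eq: "bind_pmf (step x w (cs, q)) (run x w t) = map_pmf (Pair []) \<mu>"
      using Suc.prems(1) by (simp add: computes_def run_Suc)
    \<comment> \<open>The mixture over first steps is supported on halted configurations, hence so
      is each of its components.\<close>
    have c: "computes x w t (fst k) (snd k) (map_pmf snd (run x w t k))"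
      if "k \<in> set_pmf (step x w (cs, q))" for k
    proof -
      have "set_pmf (run x w t k) \<subseteq> set_pmf (map_pmf (Pair []) \<mu>)"
        unfolding eq[symmetric] using that by auto
      then have "map_pmf (\<lambda>z. ([], snd z)) (run x w t k) = map_pmf (\<lambda>z. z) (run x w t k)"
        by (intro map_pmf_cong) auto
      then show ?thesis by (simp add: computes_def map_pmf_comp)
    qed
    have \<mu>: "\<mu> = bind_pmf (step x w (cs, q)) (\<lambda>k. map_pmf snd (run x w t k))"
    proof -
      have "map_pmf snd (map_pmf (Pair ([] :: com list)) \<mu>) = bind_pmf (step x w (cs, q)) (\<lambda>k. map_pmf snd (run x w t k))"
        unfolding eq[symmetric] by (simp add: map_bind_pmf)
      then show ?thesis by (simp add: map_pmf_comp)
    qed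
    have "run x w (Suc t + u) (cs @ ds, q) =
        bind_pmf (step x w (cs, q)) (\<lambda>k. run x w (t + u) (fst k @ ds, snd k))"
      using False by (simp add: run_Suc step_append bind_map_pmf case_prod_beta)
    also have "\<dots> = bind_pmf (step x w (cs, q))
        (\<lambda>k. map_pmf (Pair []) (bind_pmf (map_pmf snd (run x w t k)) \<nu>))"
    proof (intro bind_pmf_cong refl)
      fix k assume k: "k \<in> set_pmf (step x w (cs, q))"
      have "computes x w (t + u) (fst k @ ds) (snd k) (bind_pmf (map_pmf snd (run x w t k)) \<nu>)"
      proof (rule Suc.IH[OF c[OF k]])
        fix q' assume "q' \<in> set_pmf (map_pmf snd (run x w t k))"
        then have "q' \<in> set_pmf \<mu>" using k by (auto simp: \<mu>)
        then show "computes x w u ds q' (\<nu> q')" by (rule Suc.prems(2))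
      qed
      then show "run x w (t + u) (fst k @ ds, snd k) = map_pmf (Pair []) (bind_pmf (map_pmf snd (run x w t k)) \<nu>)"
        by (simp add: computes_def)
    qed
    also have "\<dots> = map_pmf (Pair []) (bind_pmf \<mu> \<nu>)"
      by (simp add: \<mu> map_bind_pmf bind_assoc_pmf)
    finally show ?thesis by (simp add: computes_def)
  qed
qed

lemma computes_mono:
  assumes "computes x w t cs q \<mu>" "t \<le> u"
  shows "computes x w u cs q \<mu>"
  using computes_append[OF assms(1), of "u - t" "[]" return_pmf] assms(2)
  by (simp add: computes_Nil bind_return_pmf')

lemma halts_within_iff_computes:
  "halts_within x w t c q \<longleftrightarrow> computes x w t [c] q (map_pmf snd (steps x w t c q))"
proof
  assume h: "halts_within x w t c q"
  have "map_pmf (\<lambda>z. ([], snd z)) (steps x w t c q) = map_pmf (\<lambda>z. z) (steps x w t c q)"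
    using h by (intro map_pmf_cong) (auto simp: halts_within_def)
  then show "computes x w t [c] q (map_pmf snd (steps x w t c q))"
    by (simp add: computes_def map_pmf_comp steps_eq_run)
next
  assume "computes x w t [c] q (map_pmf snd (steps x w t c q))"
  then have "set_pmf (steps x w t c q) = Pair [] ` set_pmf (map_pmf snd (steps x w t c q))"
    by (simp add: computes_def steps_eq_run flip: set_map_pmf)
  then show "halts_within x w t c q" by (auto simp: halts_within_def)
qed

lemma computes_steps:
  assumes "computes x w t [c] q \<mu>"
  shows "halts_within x w t c q" "map_pmf snd (steps x w t c q) = \<mu>"
proof -
  show 1: "map_pmf snd (steps x w t c q) = \<mu>"
    using assms by (simp add: computes_def steps_eq_run map_pmf_comp)
  show "halts_within x w t c q"
    using assms by (simp add: halts_within_iff_computes 1)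
qed

section \<open>The policies\<close>

text \<open>The memory holds the parts that are still free; the empty set, which is never a part, marks
  that the tie bit is set.\<close>

definition threshold_policy ::
  "('a \<Rightarrow> nat) \<Rightarrow> 'a set pmf \<Rightarrow> ('a set \<Rightarrow> ('a \<Rightarrow> real) \<Rightarrow> 'a set set pmf) \<Rightarrow> ('a, 'a set set) policy"
where
  "threshold_policy idx \<sigma> \<kappa> =
     \<lparr>prep = (\<lambda>s. bind_pmf \<sigma> (\<lambda>S. bind_pmf (\<kappa> S (restrict s S))
        (\<lambda>P. map_pmf (\<lambda>tb. if tb then insert {} P else P) (pmf_of_set UNIV)))),
      decide = (\<lambda>s M e v. return_pmf
        (if \<exists>B\<in>M. e \<in> B \<and> beats idx ({} \<in> M) s B e v then (True, {B \<in> M. e \<notin> B}) else (False, M)))\<rparr>"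

text \<open>The marker \<open>{}\<close> contains no element, so it neither triggers an acceptance
  nor gets deleted.\<close>

lemma accepted_from_threshold_policy:
  assumes "{} \<notin> P"
  shows "accepted_from (threshold_policy idx \<sigma> \<kappa>) s r (if tb then insert {} P else P) es =
    return_pmf (threshold_accept idx tb P s r es)"
  using assms
proof (induction es arbitrary: P)
  case Nil
  then show ?case by simp
next
  case (Cons e es)
  let ?M = "if tb then insert {} P else P"
  have tb: "({} \<in> ?M) = tb" using Cons.prems by simp
  have ex: "(\<exists>B\<in>?M. e \<in> B \<and> beats idx tb s B e (r e)) \<longleftrightarrow> (\<exists>B\<in>P. e \<in> B \<and> beats idx tb s B e (r e))"
    by auto
  have rem: "{B \<in> ?M. e \<notin> B} = (if tb then insert {} {B \<in> P. e \<notin> B} else {B \<in> P. e \<notin> B})"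
    by auto
  have dec: "decide (threshold_policy idx \<sigma> \<kappa>) s ?M e (r e) = return_pmf
      (if \<exists>B\<in>P. e \<in> B \<and> beats idx tb s B e (r e) then (True, {B \<in> ?M. e \<notin> B}) else (False, ?M))"
    by (simp only: threshold_policy_def policy.simps tb ex)
  show ?case
  proof (cases "\<exists>B\<in>P. e \<in> B \<and> beats idx tb s B e (r e)")
    case True
    have "{} \<notin> {B \<in> P. e \<notin> B}" using Cons.prems by simp
    from Cons.IH[OF this] show ?thesis
      using True by (simp only: accepted_from.simps dec if_True bind_return_pmf prod.case rem
          threshold_accept.simps map_return_pmf)
  next
    case False
    from Cons.IH[OF Cons.prems] show ?thesis
      using False by (simp only: accepted_from.simps dec if_False bind_return_pmf prod.case
          threshold_accept.simps map_return_pmf)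
  qed
qed

lemma (in partitioned_matroid) accepted_threshold_policy:
  assumes "s \<in> nonneg_vectors E"
  shows "accepted (threshold_policy idx \<sigma> \<kappa>) es s r = threshold_law idx \<sigma> \<kappa> es s r"
proof -
  have "{} \<notin> P" if "S \<in> set_pmf \<sigma>" "P \<in> set_pmf (\<kappa> S (restrict s S))" for S P
    using kernel_partition(1)[OF that(1) restrict_nonneg_vectors[OF assms observed_subset[OF that(1)]] that(2)]
    by (auto simp: partition_on_def)
  moreover have "prep (threshold_policy idx \<sigma> \<kappa>) s = bind_pmf \<sigma> (\<lambda>S. bind_pmf (\<kappa> S (restrict s S))
      (\<lambda>P. map_pmf (\<lambda>tb. if tb then insert {} P else P) (pmf_of_set UNIV)))"
    by (simp add: threshold_policy_def)
  ultimately show ?thesis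
    unfolding accepted_def threshold_law_def map_pmf_def
    by (simp only: bind_assoc_pmf bind_return_pmf)
       (intro bind_pmf_cong refl accepted_from_threshold_policy, blast)
qed

section \<open>Deterministic program fragments\<close>

definition executes ::
  "matroid_input \<Rightarrow> (nat \<Rightarrow> real) \<Rightarrow> nat \<Rightarrow> com \<Rightarrow> store \<Rightarrow> store \<Rightarrow> bool"
where
  "executes x w t c q q' \<longleftrightarrow> computes x w t [c] q (return_pmf q')"

lemma executes_mono: "executes x w t c q q' \<Longrightarrow> t \<le> u \<Longrightarrow> executes x w u c q q'"
  unfolding executes_def by (rule computes_mono)

lemma computes_Seq:
  assumes "computes x w t [c] q \<mu>" "\<And>q'. q' \<in> set_pmf \<mu> \<Longrightarrow> computes x w u [d] q' (\<nu> q')"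
  shows "computes x w (Suc (t + u)) [Seq c d] q (bind_pmf \<mu> \<nu>)"
  using computes_append[OF assms] by (intro computes_step[of _ _ "[Seq c d]" _ "[c, d]" q]) auto

lemma executes_Seq:
  "executes x w t c q q1 \<Longrightarrow> executes x w u d q1 q2 \<Longrightarrow> executes x w (Suc (t + u)) (Seq c d) q q2"
  using computes_Seq[of x w t c q "return_pmf q1" u d "\<lambda>_. return_pmf q2"]
  by (simp add: executes_def bind_return_pmf)

lemma executes_Cond:
  assumes "executes x w t (if beval x q b then c else d) q q'"
  shows "executes x w (Suc t) (Cond b c d) q q'"
  using assms unfolding executes_def by (rule computes_step[rotated]) simp

lemma executes_basic:
  "step x w ([c], q) = return_pmf ([], q') \<Longrightarrow> executes x w 1 c q q'"
  unfolding executes_def One_nat_def by (rule computes_step) (auto intro: computes_Nil)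

text \<open>Loop rule with invariant \<open>J i\<close> after \<open>i\<close> elements. Each round
  costs \<open>k\<close> steps and one test; the outer \<open>Suc\<close> is the final failing
  test.\<close>

lemma executes_While_counter:
  assumes body: "\<And>i q. i < num_elems x \<Longrightarrow> J i q \<Longrightarrow> \<exists>q'. executes x w k c q q' \<and> J (Suc i) q'"
    and counter: "\<And>i q. J i q \<Longrightarrow> nreg q 3 = i"
    and "J i q" "i \<le> num_elems x"
  shows "\<exists>q'. executes x w (Suc ((num_elems x - i) * Suc k)) (While (NLess (NReg 3) NNumElems) c) q q' \<and>
    J (num_elems x) q'"
  using assms(3,4)
proof (induction "num_elems x - i" arbitrary: i q)
  case 0
  then have "i = num_elems x" "nreg q 3 = num_elems x" using counter by auto
  moreover from this have "executes x w 1 (While (NLess (NReg 3) NNumElems) c) q q"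
    by (intro executes_basic) simp
  ultimately show ?case using 0 by auto
next
  case (Suc m)
  then have i: "i < num_elems x" by simp
  then obtain q1 where q1: "executes x w k c q q1" "J (Suc i) q1"
    using body[OF _ Suc.prems(1)] by blast
  have m: "m = num_elems x - Suc i" using Suc.hyps(2) by simp
  obtain q2 where q2: "executes x w (Suc (m * Suc k)) (While (NLess (NReg 3) NNumElems) c) q1 q2"
    "J (num_elems x) q2"
    using Suc.hyps(1)[OF m q1(2)] i unfolding m[symmetric] by auto
  have "computes x w (k + Suc (m * Suc k)) ([c] @ [While (NLess (NReg 3) NNumElems) c]) q
      (bind_pmf (return_pmf q1) (\<lambda>_. return_pmf q2))"
    using q1 q2 by (intro computes_append) (auto simp: executes_def)
  moreover have "step x w ([While (NLess (NReg 3) NNumElems) c], q) =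
      return_pmf (c # [While (NLess (NReg 3) NNumElems) c], q)"
    using counter[OF Suc.prems(1)] Suc.hyps(2) by simp
  ultimately have "executes x w (Suc (k + Suc (m * Suc k))) (While (NLess (NReg 3) NNumElems) c) q q2"
    unfolding executes_def by (intro computes_step) (auto simp: bind_return_pmf)
  then show ?case using q2(2) Suc.hyps(2)[symmetric] by (auto simp: algebra_simps)
qed

section \<open>The arrival program\<close>

definition NEq :: "nexp \<Rightarrow> nexp \<Rightarrow> bexp" where
  "NEq a b = BAnd (BNot (NLess a b)) (BNot (NLess b a))"

definition BOr :: "bexp \<Rightarrow> bexp \<Rightarrow> bexp" where
  "BOr a b = BNot (BAnd (BNot a) (BNot b))"

lemma beval_NEq [simp]: "beval x q (NEq a b) \<longleftrightarrow> neval x q a = neval x q b"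
  by (auto simp: NEq_def)

lemma beval_BOr [simp]: "beval x q (BOr a b) \<longleftrightarrow> beval x q a \<or> beval x q b"
  by (simp add: BOr_def)

text \<open>Register use on arrival: \<open>1\<close> is the decision, \<open>2\<close> the tie bit, \<open>3\<close> a loop counter and
  \<open>4\<close> the label of the part to be erased (\<open>0\<close> if there is none). Erasing a part sets the labels
  of its elements to \<open>0\<close>.\<close>

definition compare_com :: com where
  "compare_com = Seq (Observe 1 (NReg 3)) (Seq
     (Cond (BAnd (NEq (NMem (NReg 3)) (NMem (NReg 0)))
        (BNot (BOr (RLess (RReg 1) (RReg 0))
           (BAnd (BNot (RLess (RReg 0) (RReg 1)))
             (BOr (NLess (NReg 3) (NReg 0))
                (BAnd (NEq (NReg 3) (NReg 0)) (NLess (NConst 0) (NReg 2))))))))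
       (NSet 1 (NConst 0)) (NSet 1 (NReg 1)))
     (NSet 3 (NPlus (NReg 3) (NConst 1))))"

text \<open>\<open>NSet 1 (NReg 1)\<close> serves as a skip command, as it does in
  \<open>compare_com\<close>.\<close>

definition erase_com :: com where
  "erase_com = Seq
     (Cond (NEq (NMem (NReg 3)) (NReg 4)) (NStore (NReg 3) (NConst 0)) (NSet 1 (NReg 1)))
     (NSet 3 (NPlus (NReg 3) (NConst 1)))"

text \<open>Register 1 starts as the label of the arriving element, and the first loop can only
  reset it to 0; so label 0 leads to rejection. On rejection the second loop erases label 0, which
  changes nothing.\<close>

definition arrival_com :: com where
  "arrival_com = Seq (NSet 3 (NConst 0)) (Seq (NSet 1 (NMem (NReg 0)))
     (Seq (While (NLess (NReg 3) NNumElems) compare_com)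
     (Seq (Cond (NLess (NConst 0) (NReg 1)) (NSet 4 (NMem (NReg 0))) (NSet 4 (NConst 0)))
     (Seq (NSet 3 (NConst 0)) (While (NLess (NReg 3) NNumElems) erase_com)))))"

definition label_beats :: "matroid_input \<Rightarrow> (nat \<Rightarrow> real) \<Rightarrow> store \<Rightarrow> nat \<Rightarrow> real \<Rightarrow> bool" where
  "label_beats x w q e v \<longleftrightarrow> 0 < nmem q e \<and>
     beats id (0 < nreg q 2) w {e' \<in> elems x. nmem q e' = nmem q e} e v"

lemma executes_compare_loop:
  assumes "e \<in> elems x" "nreg q 0 = e" "rreg q 0 = v" "nreg q 1 = nmem q e" "nreg q 3 = 0"
  shows "\<exists>q'. executes x w (Suc (num_elems x * 7)) (While (NLess (NReg 3) NNumElems) compare_com) q q' \<and>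
    nmem q' = nmem q \<and> nreg q' 0 = e \<and> nreg q' 2 = nreg q 2 \<and>
    (0 < nreg q' 1 \<longleftrightarrow> label_beats x w q e v)"
proof -
  define bt where "bt e' \<longleftrightarrow> w e' < v \<or> w e' = v \<and> (e' < e \<or> e' = e \<and> 0 < nreg q 2)" for e'
  \<comment> \<open>Register 1 stays positive as long as \<open>e\<close> has a positive label and
    no sample of its part seen so far prevails.\<close>
  define J where "J i q' \<longleftrightarrow> nmem q' = nmem q \<and> nreg q' 0 = e \<and> rreg q' 0 = v \<and> nreg q' 2 = nreg q 2 \<and>
    nreg q' 3 = i \<and> (0 < nreg q' 1 \<longleftrightarrow> 0 < nmem q e \<and> (\<forall>e'<i. nmem q e' = nmem q e \<longrightarrow> bt e'))" for i and q' :: store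
  have "\<exists>q'. executes x w (Suc ((num_elems x - 0) * Suc 6)) (While (NLess (NReg 3) NNumElems) compare_com) q q' \<and>
      J (num_elems x) q'"
  proof (rule executes_While_counter)
    show "J 0 q" using assms by (simp add: J_def)
    show "nreg q' 3 = i" if "J i q'" for i q' using that by (simp add: J_def)
    fix i q1 assume i: "i < num_elems x" and J: "J i q1"
    define q2 where "q2 = q1\<lparr>rreg := (rreg q1)(1 := w i), observed := insert i (observed q1)\<rparr>"
    define q3 where "q3 = q2\<lparr>nreg := (nreg q2)(1 := if nmem q i = nmem q e \<and> \<not> bt i then 0 else nreg q2 1)\<rparr>"
    define q4 where "q4 = q3\<lparr>nreg := (nreg q3)(3 := Suc i)\<rparr>"
    have 1: "executes x w 1 (Observe 1 (NReg 3)) q1 q2"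
      using J i by (intro executes_basic) (simp add: q2_def J_def elems_def)
    have 2: "executes x w (Suc 1) (Cond (BAnd (NEq (NMem (NReg 3)) (NMem (NReg 0)))
        (BNot (BOr (RLess (RReg 1) (RReg 0))
           (BAnd (BNot (RLess (RReg 0) (RReg 1)))
             (BOr (NLess (NReg 3) (NReg 0))
                (BAnd (NEq (NReg 3) (NReg 0)) (NLess (NConst 0) (NReg 2))))))))
       (NSet 1 (NConst 0)) (NSet 1 (NReg 1))) q2 q3"
      using J by (intro executes_Cond executes_basic) (auto simp: q3_def q2_def J_def bt_def)
    have 3: "executes x w 1 (NSet 3 (NPlus (NReg 3) (NConst 1))) q3 q4"
      using J by (intro executes_basic) (simp add: q4_def q3_def q2_def J_def)
    have "executes x w 6 compare_com q1 q4"
      using executes_Seq[OF 1 executes_Seq[OF 2 3]] by (simp add: compare_com_def numeral_eq_Suc)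
    moreover have "J (Suc i) q4"
      using J by (auto simp: J_def q4_def q3_def q2_def less_Suc_eq)
    ultimately show "\<exists>q'. executes x w 6 compare_com q1 q' \<and> J (Suc i) q'" by blast
  qed simp
  then obtain q' where "executes x w (Suc (num_elems x * 7)) (While (NLess (NReg 3) NNumElems) compare_com) q q'"
    "J (num_elems x) q'" by auto
  then show ?thesis
    by (intro exI[of _ q']) (auto simp: J_def label_beats_def beats_def bt_def elems_def)
qed

lemma executes_erase_loop:
  assumes "nreg q 3 = 0"
  shows "\<exists>q'. executes x w (Suc (num_elems x * 5)) (While (NLess (NReg 3) NNumElems) erase_com) q q' \<and>
    nreg q' 1 = nreg q 1 \<and> nreg q' 2 = nreg q 2 \<and>
    nmem q' = (\<lambda>k. if k < num_elems x \<and> nmem q k = nreg q 4 then 0 else nmem q k)"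
proof -
  define J where "J i q' \<longleftrightarrow> nreg q' 1 = nreg q 1 \<and> nreg q' 2 = nreg q 2 \<and> nreg q' 4 = nreg q 4 \<and>
    nreg q' 3 = i \<and> nmem q' = (\<lambda>k. if k < i \<and> nmem q k = nreg q 4 then 0 else nmem q k)" for i and q' :: store
  have "\<exists>q'. executes x w (Suc ((num_elems x - 0) * Suc 4)) (While (NLess (NReg 3) NNumElems) erase_com) q q' \<and>
      J (num_elems x) q'"
  proof (rule executes_While_counter)
    show "J 0 q" using assms by (simp add: J_def)
    show "nreg q' 3 = i" if "J i q'" for i q' using that by (simp add: J_def)
    fix i q1 assume i: "i < num_elems x" and J: "J i q1"
    define q2 where "q2 = (if nmem q i = nreg q 4 then q1\<lparr>nmem := (nmem q1)(i := 0)\<rparr>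
        else q1\<lparr>nreg := (nreg q1)(1 := nreg q1 1)\<rparr>)"
    define q3 where "q3 = q2\<lparr>nreg := (nreg q2)(3 := Suc i)\<rparr>"
    have 1: "executes x w (Suc 1) (Cond (NEq (NMem (NReg 3)) (NReg 4)) (NStore (NReg 3) (NConst 0))
        (NSet 1 (NReg 1))) q1 q2"
      using J by (intro executes_Cond executes_basic) (auto simp: q2_def J_def)
    have 2: "executes x w 1 (NSet 3 (NPlus (NReg 3) (NConst 1))) q2 q3"
      using J by (intro executes_basic) (simp add: q3_def q2_def J_def)
    have "executes x w 4 erase_com q1 q3"
      using executes_Seq[OF 1 2] by (simp add: erase_com_def numeral_eq_Suc)
    moreover have "J (Suc i) q3"
      using J by (auto simp: J_def q3_def q2_def less_Suc_eq fun_eq_iff)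
    ultimately show "\<exists>q'. executes x w 4 erase_com q1 q' \<and> J (Suc i) q'" by blast
  qed simp
  then show ?thesis by (auto simp: J_def)
qed

text \<open>Each element costs 7 steps in the comparison loop and 5 in the erasing loop; the
  constant bounds the commands around them.\<close>

lemma executes_arrival:
  assumes e: "e \<in> elems x"
  shows "\<exists>q'. executes x w (12 * num_elems x + 13) arrival_com (arrive e v q) q' \<and>
    (0 < nreg q' 1 \<longleftrightarrow> label_beats x w q e v) \<and> nreg q' 2 = nreg q 2 \<and>
    (\<forall>k\<in>elems x. nmem q' k = (if label_beats x w q e v \<and> nmem q k = nmem q e then 0 else nmem q k))"
proof -
  define q1 where "q1 = (arrive e v q)\<lparr>nreg := (nreg (arrive e v q))(3 := 0)\<rparr>"
  define q2 where "q2 = q1\<lparr>nreg := (nreg q1)(1 := nmem q1 e)\<rparr>"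
  have 1: "executes x w 1 (NSet 3 (NConst 0)) (arrive e v q) q1"
    by (intro executes_basic) (simp add: q1_def)
  have 2: "executes x w 1 (NSet 1 (NMem (NReg 0))) q1 q2"
    by (intro executes_basic) (simp add: q2_def q1_def arrive_def)
  obtain q3 where 3: "executes x w (Suc (num_elems x * 7)) (While (NLess (NReg 3) NNumElems) compare_com) q2 q3"
    and q3: "nmem q3 = nmem q" "nreg q3 0 = e" "nreg q3 2 = nreg q 2" "0 < nreg q3 1 \<longleftrightarrow> label_beats x w q e v"
  proof -
    have "label_beats x w q2 e v = label_beats x w q e v" "nmem q2 = nmem q" "nreg q2 2 = nreg q 2"
      "nreg q2 0 = e" "rreg q2 0 = v" "nreg q2 1 = nmem q2 e" "nreg q2 3 = 0"
      by (simp_all add: q2_def q1_def arrive_def label_beats_def)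
    then show ?thesis using executes_compare_loop[OF e, of q2 v w] that by metis
  qed
  define q4 where "q4 = q3\<lparr>nreg := (nreg q3)(4 := if 0 < nreg q3 1 then nmem q e else 0)\<rparr>"
  define q5 where "q5 = q4\<lparr>nreg := (nreg q4)(3 := 0)\<rparr>"
  have 4: "executes x w (Suc 1) (Cond (NLess (NConst 0) (NReg 1)) (NSet 4 (NMem (NReg 0))) (NSet 4 (NConst 0))) q3 q4"
    by (intro executes_Cond executes_basic) (auto simp: q4_def q3)
  have 5: "executes x w 1 (NSet 3 (NConst 0)) q4 q5"
    by (intro executes_basic) (simp add: q5_def)
  obtain q6 where 6: "executes x w (Suc (num_elems x * 5)) (While (NLess (NReg 3) NNumElems) erase_com) q5 q6"
    and q6: "nreg q6 1 = nreg q5 1" "nreg q6 2 = nreg q5 2"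
      "nmem q6 = (\<lambda>k. if k < num_elems x \<and> nmem q5 k = nreg q5 4 then 0 else nmem q5 k)"
    using executes_erase_loop[of q5 x w] by (auto simp: q5_def)
  have "executes x w (12 * num_elems x + 13) arrival_com (arrive e v q) q6"
    unfolding arrival_com_def
    by (rule executes_mono[OF executes_Seq[OF 1 executes_Seq[OF 2 executes_Seq[OF 3 executes_Seq[OF 4
            executes_Seq[OF 5 6]]]]]]) simp
  then show ?thesis
    by (intro exI[of _ q6]) (auto simp: q6 q5_def q4_def q3 elems_def simp del: One_nat_def)
qed

text \<open>Label 0 stands for no part, so resetting one label deletes exactly the part of
  \<open>e\<close>.\<close>

lemma parts_erase:
  assumes e: "e \<in> elems x" "0 < nmem q e"
    and q': "\<And>k. k \<in> elems x \<Longrightarrow> nmem q' k = (if nmem q k = nmem q e then 0 else nmem q k)"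
  shows "parts x q' = {B \<in> parts x q. e \<notin> B}"
proof -
  have eq: "{k \<in> elems x. nmem q' k = l} = (if l = nmem q e then {} else {k \<in> elems x. nmem q k = l})" if "0 < l" for l
    using q' that by auto
  show ?thesis
  proof (intro set_eqI iffI)
    fix B assume "B \<in> parts x q'"
    then obtain l where l: "0 < l" "B = {k \<in> elems x. nmem q' k = l}" "B \<noteq> {}"
      by (auto simp: parts_def)
    then have "l \<noteq> nmem q e" "B = {k \<in> elems x. nmem q k = l}" using eq[OF l(1)] by (auto split: if_splits)
    then show "B \<in> {B \<in> parts x q. e \<notin> B}" using l by (auto simp: parts_def)
  next
    fix B assume "B \<in> {B \<in> parts x q. e \<notin> B}"
    then obtain l where l: "0 < l" "B = {k \<in> elems x. nmem q k = l}" "B \<noteq> {}" "e \<notin> B"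
      by (auto simp: parts_def)
    then have "B = {k \<in> elems x. nmem q' k = l}" using eq[OF l(1)] e(1) by auto
    then show "B \<in> parts x q'" using l unfolding parts_def by blast
  qed
qed

lemma parts_cong: "(\<And>k. k \<in> elems x \<Longrightarrow> nmem q' k = nmem q k) \<Longrightarrow> parts x q' = parts x q"
proof -
  assume "\<And>k. k \<in> elems x \<Longrightarrow> nmem q' k = nmem q k"
  then have "{k \<in> elems x. nmem q' k = l} = {k \<in> elems x. nmem q k = l}" for l by auto
  then show ?thesis unfolding parts_def by simp
qed

lemma label_beats_iff:
  assumes e: "e \<in> elems x"
  shows "label_beats x w q e v \<longleftrightarrow> (\<exists>B\<in>parts x q. e \<in> B \<and> beats id (0 < nreg q 2) w B e v)"
proof
  assume "label_beats x w q e v"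
  then show "\<exists>B\<in>parts x q. e \<in> B \<and> beats id (0 < nreg q 2) w B e v"
    using e unfolding label_beats_def parts_def
    by (intro bexI[of _ "{e' \<in> elems x. nmem q e' = nmem q e}"]) auto
next
  assume "\<exists>B\<in>parts x q. e \<in> B \<and> beats id (0 < nreg q 2) w B e v"
  then obtain B l where "0 < l" "B = {k \<in> elems x. nmem q k = l}" "e \<in> B" "beats id (0 < nreg q 2) w B e v"
    by (auto simp: parts_def)
  then show "label_beats x w q e v" by (auto simp: label_beats_def)
qed

text \<open>The labels represent the free parts and register 2 the tie bit. Each arrival updates
  them as the recursion of \<open>threshold_accept\<close> does, whatever else the store
  contains.\<close>

lemma accepted_from_program_policy:
  assumes t: "12 * num_elems x + 13 \<le> t" and "distinct es" "set es \<subseteq> elems x"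
  shows "accepted_from (program_policy x t c arrival_com) s r q es =
    return_pmf (threshold_accept id (0 < nreg q 2) (parts x q) s r es)"
  using assms(2,3)
proof (induction es arbitrary: q)
  case Nil
  then show ?case by simp
next
  case (Cons e es)
  have e: "e \<in> elems x" using Cons.prems by simp
  obtain q' where q': "executes x s (12 * num_elems x + 13) arrival_com (arrive e (r e) q) q'"
    "0 < nreg q' 1 \<longleftrightarrow> label_beats x s q e (r e)" "nreg q' 2 = nreg q 2"
    "\<forall>k\<in>elems x. nmem q' k = (if label_beats x s q e (r e) \<and> nmem q k = nmem q e then 0 else nmem q k)"
    using executes_arrival[OF e, of s "r e" q] by (elim exE conjE) (rule that)
  have "computes x s t [arrival_com] (arrive e (r e) q) (return_pmf q')"
    using executes_mono[OF q'(1) t] by (simp add: executes_def)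
  then have "steps x s t arrival_com (arrive e (r e) q) = return_pmf ([], q')"
    by (simp add: computes_def steps_eq_run)
  then have dec: "decide (program_policy x t c arrival_com) s q e (r e) = return_pmf (label_beats x s q e (r e), q')"
    using q'(2) by (simp add: program_policy_def)
  have parts: "parts x q' = (if label_beats x s q e (r e) then {B \<in> parts x q. e \<notin> B} else parts x q)"
  proof (cases "label_beats x s q e (r e)")
    case True
    have "parts x q' = {B \<in> parts x q. e \<notin> B}"
    proof (rule parts_erase[OF e])
      show "0 < nmem q e" using True unfolding label_beats_def by blast
      show "nmem q' k = (if nmem q k = nmem q e then 0 else nmem q k)" if "k \<in> elems x" for k
        using bspec[OF q'(4) that] True by (simp only: simp_thms)
    qed
    then show ?thesis unfolding if_P[OF True] .
  next
    case False
    have "parts x q' = parts x q"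
    proof (rule parts_cong)
      show "nmem q' k = nmem q k" if "k \<in> elems x" for k
        using bspec[OF q'(4) that] False by (simp only: simp_thms if_False)
    qed
    then show ?thesis unfolding if_not_P[OF False] .
  qed
  have "accepted_from (program_policy x t c arrival_com) s r q' es =
      return_pmf (threshold_accept id (0 < nreg q 2) (parts x q') s r es)"
    using Cons.IH[of q'] Cons.prems q'(3) by (simp del: id_apply)
  then show ?case
    by (cases "label_beats x s q e (r e)")
       (simp_all add: dec bind_return_pmf parts label_beats_iff[OF e, symmetric] del: id_apply)
qed

section \<open>The preparation program and the complete program policy\<close>

definition preparation_com :: "com \<Rightarrow> com" where
  "preparation_com c = Seq c (Rand 2 (NConst 1))"

text \<open>The tie bit is drawn after the partitioning and put into register 2, which leaves the
  labels intact. The two extra steps are for \<open>Seq\<close> and \<open>Rand\<close>.\<close>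

lemma computes_preparation:
  assumes "halts_within x w t c blank"
  shows "computes x w (t + 2) [preparation_com c] blank (bind_pmf (map_pmf snd (steps x w t c blank))
    (\<lambda>q. map_pmf (\<lambda>k. q\<lparr>nreg := (nreg q)(2 := k)\<rparr>) (pmf_of_set {0..1})))"
proof -
  have "computes x w 1 [Rand 2 (NConst 1)] q (map_pmf (\<lambda>k. q\<lparr>nreg := (nreg q)(2 := k)\<rparr>) (pmf_of_set {0..1}))" for q
    using run_Suc[of x w 0 "([Rand 2 (NConst 1)], q)"]
    by (simp add: computes_def run_0[abs_def] bind_return_pmf' map_pmf_comp)
  from computes_Seq[OF assms[unfolded halts_within_iff_computes] this]
  show ?thesis by (simp add: preparation_com_def)
qed

lemma map_pmf_of_set_pos: "map_pmf (\<lambda>k. 0 < k) (pmf_of_set {0..1 :: nat}) = pmf_of_set UNIV"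
proof -
  have "(\<lambda>k. 0 < k) ` {0..1 :: nat} = UNIV"
    by (auto simp: UNIV_bool image_iff intro: bexI[of _ 0] bexI[of _ 1])
  moreover have "inj_on (\<lambda>k. 0 < k) {0..1 :: nat}" by (auto simp: inj_on_def)
  ultimately show ?thesis by (subst map_pmf_of_set_inj) auto
qed

text \<open>Run on the samples, the partitioning program produces parts with the law given by
  \<open>\<sigma>\<close> and \<open>\<kappa>\<close>. The observed set is projected away, because
  arrivals are governed by the labels and the tie bit.\<close>

lemma accepted_program_policy:
  assumes halts: "halts_within x s t0 c blank"
    and law: "map_pmf (\<lambda>(cs, q). (observed q, parts x q)) (steps x s t0 c blank) =
      bind_pmf \<sigma> (\<lambda>S. map_pmf (\<lambda>P. (S, P)) (\<kappa> S (restrict s S)))"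
    and t: "t0 + 2 \<le> t" "12 * num_elems x + 13 \<le> t"
    and es: "arrival_order (elems x) es"
  shows "accepted (program_policy x t (preparation_com c) arrival_com) es s r = threshold_law id \<sigma> \<kappa> es s r"
proof -
  let ?\<mu> = "map_pmf snd (steps x s t0 c blank)"
  let ?acc = "\<lambda>tb P. threshold_accept id tb P s r es"
  have "prep (program_policy x t (preparation_com c) arrival_com) s =
      bind_pmf ?\<mu> (\<lambda>q. map_pmf (\<lambda>k. q\<lparr>nreg := (nreg q)(2 := k)\<rparr>) (pmf_of_set {0..1}))"
    using computes_steps(2)[OF computes_mono[OF computes_preparation[OF halts] t(1)]]
    by (simp add: program_policy_def)
  moreover have "parts x (q\<lparr>nreg := f\<rparr>) = parts x q" for q f by (simp add: parts_def)
  ultimately have "accepted (program_policy x t (preparation_com c) arrival_com) es s r =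
      bind_pmf ?\<mu> (\<lambda>q. bind_pmf (pmf_of_set {0..1}) (\<lambda>k. return_pmf (?acc (0 < (k :: nat)) (parts x q))))"
    using es by (simp add: accepted_def bind_assoc_pmf bind_map_pmf arrival_order_def
        accepted_from_program_policy[OF t(2)])
  also have "\<dots> = bind_pmf ?\<mu> (\<lambda>q. map_pmf (\<lambda>tb. ?acc tb (parts x q)) (pmf_of_set UNIV))"
    unfolding map_pmf_of_set_pos[symmetric] map_pmf_comp by (simp add: map_pmf_def)
  also have "\<dots> = bind_pmf (map_pmf snd (map_pmf (\<lambda>(cs, q). (observed q, parts x q)) (steps x s t0 c blank)))
      (\<lambda>P. map_pmf (\<lambda>tb. ?acc tb P) (pmf_of_set UNIV))"
    by (simp add: map_pmf_comp bind_map_pmf case_prod_beta)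
  also have "\<dots> = threshold_law id \<sigma> \<kappa> es s r"
    unfolding law threshold_law_def by (simp add: map_bind_pmf map_pmf_comp bind_assoc_pmf)
  finally show ?thesis .
qed

lemma policy_halts_program:
  assumes "\<And>s. s \<in> nonneg_vectors (elems x) \<Longrightarrow> halts_within x s t0 c blank"
    and t: "t0 + 2 \<le> t" "12 * num_elems x + 13 \<le> t"
  shows "policy_halts x t (preparation_com c) arrival_com"
  unfolding policy_halts_def
proof (intro ballI conjI allI impI)
  fix s assume s: "s \<in> nonneg_vectors (elems x)"
  show "halts_within x s t (preparation_com c) blank"
    by (rule computes_steps(1)[OF computes_mono[OF computes_preparation[OF assms(1)[OF s]] t(1)]])
  fix F q e and v :: real
  assume "reachable (elems x) (program_policy x t (preparation_com c) arrival_com) s F q \<and>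
    e \<in> elems x - F \<and> 0 \<le> v"
  then have "e \<in> elems x" by simp
  then obtain q' where "executes x s (12 * num_elems x + 13) arrival_com (arrive e v q) q'"
    using executes_arrival by blast
  then have "executes x s t arrival_com (arrive e v q) q'" using t(2) by (rule executes_mono)
  then show "halts_within x s t arrival_com (arrive e v q)"
    unfolding executes_def by (rule computes_steps(1))
qed

theorem theorem6:
  shows "(\<forall>(E :: 'a set) (I :: 'a set set) (\<alpha> :: real).
            matroid E I \<and> 1 \<le> \<alpha> \<and> alpha_partition_property E I \<alpha> \<longrightarrow>
            (\<exists>\<pi> :: ('a, 'a set set) policy.
               valid_policy E I \<pi> \<and> competitive (2 * \<alpha>) E I \<pi>)) \<and>
         (\<forall>(C :: matroid_input set) (\<alpha> :: matroid_input \<Rightarrow> real).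
            (\<forall>x\<in>C. matroid (elems x) (indep x) \<and> 1 \<le> \<alpha> x) \<and> polytime_partitioning C \<alpha> \<longrightarrow>
            (\<exists>(c :: com) (d :: com) (p :: nat poly). \<forall>x\<in>C.
               let t = poly p (input_size x) in
               policy_halts x t c d \<and>
               valid_policy (elems x) (indep x) (program_policy x t c d) \<and>
               competitive (2 * \<alpha> x) (elems x) (indep x) (program_policy x t c d)))"
proof (intro conjI allI impI)
  fix E :: "'a set" and I :: "'a set set" and \<alpha> :: real
  assume *: "matroid E I \<and> 1 \<le> \<alpha> \<and> alpha_partition_property E I \<alpha>"
  then obtain \<sigma> \<kappa> where part: "alpha_partitioning E I \<alpha> \<sigma> \<kappa>"
    by (auto simp: alpha_partition_property_def)
  have "finite E" using * by (simp add: matroid_def)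
  then obtain idx :: "'a \<Rightarrow> nat" where "inj_on idx E" using finite_imp_inj_to_nat_seg by blast
  then interpret partitioned_matroid E I \<alpha> \<sigma> \<kappa> idx using * part by unfold_locales auto
  show "\<exists>\<pi> :: ('a, 'a set set) policy. valid_policy E I \<pi> \<and> competitive (2 * \<alpha>) E I \<pi>"
    using valid_and_competitive[OF accepted_threshold_policy] by blast
next
  fix C :: "matroid_input set" and \<alpha> :: "matroid_input \<Rightarrow> real"
  assume *: "(\<forall>x\<in>C. matroid (elems x) (indep x) \<and> 1 \<le> \<alpha> x) \<and> polytime_partitioning C \<alpha>"
  then obtain c p0 where c: "\<forall>x\<in>C. \<exists>\<sigma> \<kappa>.
        alpha_partitioning (elems x) (indep x) (\<alpha> x) \<sigma> \<kappa> \<and>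
        (\<forall>w\<in>nonneg_vectors (elems x).
           halts_within x w (poly p0 (input_size x)) c blank \<and>
           map_pmf (\<lambda>(cs, q). (observed q, parts x q)) (steps x w (poly p0 (input_size x)) c blank) =
             bind_pmf \<sigma> (\<lambda>S. map_pmf (\<lambda>P. (S, P)) (\<kappa> S (restrict w S))))"
    unfolding polytime_partitioning_def by (elim conjE exE)
  \<comment> \<open>One polynomial bounds both programs: \<open>p0\<close> plus 2 steps for the
    preparation, and 13 plus 12 per element for an arrival.\<close>
  let ?p = "p0 + [:15, 12:]"
  have "policy_halts x t (preparation_com c) arrival_com \<and>
      valid_policy (elems x) (indep x) (program_policy x t (preparation_com c) arrival_com) \<and>
      competitive (2 * \<alpha> x) (elems x) (indep x) (program_policy x t (preparation_com c) arrival_com)"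
    if x: "x \<in> C" and t_def: "t = poly ?p (input_size x)" for x t
  proof -
    obtain \<sigma> \<kappa> where part: "alpha_partitioning (elems x) (indep x) (\<alpha> x) \<sigma> \<kappa>"
      and prog: "\<And>w. w \<in> nonneg_vectors (elems x) \<Longrightarrow> halts_within x w (poly p0 (input_size x)) c blank"
        "\<And>w. w \<in> nonneg_vectors (elems x) \<Longrightarrow>
           map_pmf (\<lambda>(cs, q). (observed q, parts x q)) (steps x w (poly p0 (input_size x)) c blank) =
             bind_pmf \<sigma> (\<lambda>S. map_pmf (\<lambda>P. (S, P)) (\<kappa> S (restrict w S)))"
      using bspec[OF c x] by blast
    interpret partitioned_matroid "elems x" "indep x" "\<alpha> x" \<sigma> \<kappa> id
      using * x part by unfold_locales auto
    have t: "poly p0 (input_size x) + 2 \<le> t" "12 * num_elems x + 13 \<le> t"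
      by (simp_all add: t_def input_size_def)
    show ?thesis
    proof (intro conjI[OF policy_halts_program[OF prog(1) t]] valid_and_competitive)
      fix es s r assume es: "arrival_order (elems x) es" and s: "s \<in> nonneg_vectors (elems x)"
      show "accepted (program_policy x t (preparation_com c) arrival_com) es s r = threshold_law id \<sigma> \<kappa> es s r"
        by (rule accepted_program_policy[OF prog(1)[OF s] _ t es]) (rule prog(2)[OF s])
    qed
  qed
  then show "\<exists>(c :: com) (d :: com) (p :: nat poly). \<forall>x\<in>C.
      let t = poly p (input_size x) in
      policy_halts x t c d \<and>
      valid_policy (elems x) (indep x) (program_policy x t c d) \<and>
      competitive (2 * \<alpha> x) (elems x) (indep x) (program_policy x t c d)"
    unfolding Let_def by blast
qed

end
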